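(* Let $G$ and $G'$ be finite signed graphs (not necessarily embedded) in a closed, connected, orientable surface $S$ of genus $g$, and let $\Lambda=\mathbb{Z}[x_1^{\pm1},y_1^{\pm1},\ldots,x_g^{\pm1},y_g^{\pm1}]$. If $G'$ is the result of applying a Reidemeister graph move to $G$, then the Laplacian modules $\mathcal{L}_G$ and $\mathcal{L}_{G'}$ are isomorphic as $\Lambda$-modules.
   Context: Signed graphs: a graph $G$ in $S$ (loops and multiple edges allowed; edges are paths in $S$ joining vertices) is signed if each edge $e$ is labeled with a sign $\sigma_e\in\{+1,-1\}$. Connections: fix an orientation of $S$ and a symplectic basis $\{x_1,y_1,\ldots,x_g,y_g\}$ of $H_1(S;\mathbb{Z})$, represented by oriented closed curves in $S$ that miss the vertices of $G$ and are transverse to its edges. Write $H_1(S;\mathbb{Z})$ (the deck group of the universal abelian cover of $S$) multiplicatively, so its elements are monomials in the variables $x_i,y_i$ and its group ring is $\Lambda$. A directed path $P$ in $S$ transverse to the basis curves determines a monomial $\phi_P$: travel along $P$ and record $y_k^{\pm1}$ at each crossing with the curve $x_k$ and $x_k^{\pm1}$ at each crossing with the curve $y_k$, the sign of the exponent being given by the direction of crossing, with the sign conventions chosen so that for a closed path $P$ the monomial $\phi_P$ is the homology class of $P$. For a directed edge $e$, $\phi_e$ is called its connection; reversing the direction inverts $\phi_e$. Laplacian module: replace each undirected edge (including loops) by two oppositely directed edges with the same endpoints and the same sign. Let $v_1,\ldots,v_n$ be the vertices. Let $A_G=(a_{i,j})$ be the $n\times n$ matrix with $a_{i,j}=\sum\sigma_e\phi_e$,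 the sum over all directed edges $e$ from $v_i$ to $v_j$ (for $i=j$, each loop contributes $\sigma_e(\phi_e+\phi_e^{-1})$). Let $\delta_G$ be the diagonal matrix whose $i$-th entry is the sum of the signs of all directed edges leaving $v_i$ (each loop at $v_i$ counts twice). The Laplacian matrix is $L_G=\delta_G-A_G$, and the Laplacian module is $\mathcal{L}_G=\Lambda^n/\Lambda^nL_G$ (generators the vertices, relations the rows of $L_G$). Reidemeister graph moves: these are the following moves and their inverses (edges and vertices not mentioned are unchanged). (I) Add a new vertex $w$ and a single edge of sign $\pm1$ joining $w$ to an existing vertex; or add to a vertex a contractible loop (connection $1$) of sign $\pm1$. (II) Add two parallel edges of opposite signs, homotopic rel endpoints in $S$ (hence with equal connections), joining two (possibly equal) vertices; or, if $w$ is a vertex incident to exactly two edges, of opposite signs, joining $w$ to distinct vertices $v_1\neq v_2$ (both different from $w$), contract both of these edges in $S$, so that $v_1,w,v_2$ become one vertex. (III) (Star-triangle) Let $v$ be a vertex incident to exactly three edges, joining it to vertices $w_1,w_2,w_3$ (different from $v$) with signs $\sigma_1,\sigma_2,\sigma_3$ not all equal. Delete $v$ and these three edges, and add, for each $\{i,j,k\}=\{1,2,3\}$, an edge joining $w_j$ to $w_k$ homotopic in $S$ to the path from $w_j$ through $v$ to $w_k$ along the deleted edges (so its connection is the product of those along this path), with sign $-\sigma_i$. *)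

theory Defs
  imports "HOL-Analysis.Analysis" "HOL-Homology.Homology"
begin

text \<open>A surface is a subset \<open>S\<close> of a Hausdorff space, with the subspace topology.  Transversality is
  a differential notion, and signs of crossings need an orientation, so \<open>S\<close> carries an oriented
  \<open>C\<^sup>1\<close> atlas (in particular every oriented smooth structure will do).\<close>

type_synonym 'a chart = "'a set \<times> ('a \<Rightarrow> real^2)"

definition oriented_atlas :: "'a::t2_space set \<Rightarrow> 'a chart set \<Rightarrow> bool" where
  "oriented_atlas S A \<longleftrightarrow>
     (\<Union>(U,f)\<in>A. U) = S \<and>
     (\<forall>(U,f)\<in>A. openin (top_of_set S) U \<and> open (f ` U) \<and> homeomorphism U (f ` U) f (inv_into U f)) \<and>
     (\<forall>(U,f)\<in>A. \<forall>(W,h)\<in>A. \<exists>J :: real^2 \<Rightarrow> real^2^2.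
        continuous_on (f ` (U \<inter> W)) J \<and>
        (\<forall>z\<in>f ` (U \<inter> W). ((h \<circ> inv_into U f) has_derivative (\<lambda>v. J z *v v)) (at z) \<and> det (J z) > 0))"

abbreviation H1 :: "'a::t2_space set \<Rightarrow> 'a chain set monoid" where
  "H1 S \<equiv> homology_group 1 (top_of_set S)"

text \<open>Closed, connected, oriented surface; the genus is half the rank of the first homology.\<close>

definition closed_oriented_surface :: "'a::t2_space set \<Rightarrow> 'a chart set \<Rightarrow> nat \<Rightarrow> bool" where
  "closed_oriented_surface S A g \<longleftrightarrow>
     S \<noteq> {} \<and> compact S \<and> connected S \<and> oriented_atlas S A \<and>
     H1 S \<cong> free_Abelian_group {..<2*g}"


section \<open>Crossings, the intersection form, symplectic bases\<close>

text \<open>Closed curves are 1-periodic, so that a crossing at the parameter value 0 is no special case.\<close>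

definition closed_curve :: "'a::t2_space set \<Rightarrow> (real \<Rightarrow> 'a) \<Rightarrow> bool" where
  "closed_curve S c \<longleftrightarrow> continuous_on UNIV c \<and> range c \<subseteq> S \<and> (\<forall>s. c (s + 1) = c s)"

definition meetings :: "(real \<Rightarrow> 'a::t2_space) \<Rightarrow> (real \<Rightarrow> 'a) \<Rightarrow> (real \<times> real) set" where
  "meetings p c = {(t,s). t \<in> {0..1} \<and> s \<in> {0..<1} \<and> p t = c s}"

text \<open>Meetings of the path \<open>p\<close> with the closed curve \<open>c\<close> where both have velocities, in the order
  \<open>(p, c)\<close> forming a positive (\<open>\<epsilon> = 1\<close>) or negative (\<open>\<epsilon> = -1\<close>) basis of the tangent plane.\<close>

definition crossings ::
    "'a::t2_space chart set \<Rightarrow> real \<Rightarrow> (real \<Rightarrow> 'a) \<Rightarrow> (real \<Rightarrow> 'a) \<Rightarrow> (real \<times> real) set" where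
  "crossings A \<epsilon> p c = {(t,s) \<in> meetings p c. \<exists>(U,f)\<in>A. p t \<in> U \<and>
     (\<exists>u v. (f \<circ> p has_vector_derivative u) (at t) \<and> (f \<circ> c has_vector_derivative v) (at s) \<and>
            sgn (det (vector [u, v] :: real^2^2)) = \<epsilon>)}"

text \<open>A transverse path ends off the curve.  Finiteness is automatic for continuous \<open>p\<close> and \<open>c\<close>,
  because transverse meetings are isolated.\<close>

definition transverse :: "'a::t2_space chart set \<Rightarrow> (real \<Rightarrow> 'a) \<Rightarrow> (real \<Rightarrow> 'a) \<Rightarrow> bool" where
  "transverse A p c \<longleftrightarrow>
     pathstart p \<notin> range c \<and> pathfinish p \<notin> range c \<and> finite (meetings p c) \<and>
     meetings p c \<subseteq> crossings A 1 p c \<union> crossings A (-1) p c"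

definition crossing_number :: "'a::t2_space chart set \<Rightarrow> (real \<Rightarrow> 'a) \<Rightarrow> (real \<Rightarrow> 'a) \<Rightarrow> int" where
  "crossing_number A p c = int (card (crossings A 1 p c)) - int (card (crossings A (-1) p c))"

text \<open>The class of a closed path, regarded as a singular 1-simplex: \<open>x 1\<close> is the barycentric
  coordinate that runs from 0 to 1 along the standard 1-simplex.\<close>

definition loop_class :: "'a::t2_space set \<Rightarrow> (real \<Rightarrow> 'a) \<Rightarrow> 'a chain set" where
  "loop_class S p =
     homologous_rel_set 1 (top_of_set S) {} (frag_of (\<lambda>x\<in>standard_simplex 1. p (x 1)))"

text \<open>The algebraic intersection form on the first homology.  It is unique, as every pair of classes
  is represented by a pair of transverse closed curves.\<close>

definition intersection_form ::
    "'a::t2_space set \<Rightarrow> 'a chart set \<Rightarrow> ('a chain set \<Rightarrow> 'a chain set \<Rightarrow> int) \<Rightarrow> bool" where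
  "intersection_form S A \<omega> \<longleftrightarrow>
     (\<forall>a\<in>carrier (H1 S). \<forall>b\<in>carrier (H1 S). \<forall>d\<in>carrier (H1 S).
        \<omega> (a \<otimes>\<^bsub>H1 S\<^esub> b) d = \<omega> a d + \<omega> b d \<and> \<omega> d (a \<otimes>\<^bsub>H1 S\<^esub> b) = \<omega> d a + \<omega> d b) \<and>
     (\<forall>a\<in>carrier (H1 S). \<omega> a a = 0) \<and>
     (\<forall>p c. path p \<and> path_image p \<subseteq> S \<and> pathfinish p = pathstart p \<and> closed_curve S c \<and>
        transverse A p c \<longrightarrow> \<omega> (loop_class S p) (loop_class S c) = crossing_number A p c)"

text \<open>The basis elements, also the variables of the Laurent polynomials, are \<open>x\<^sub>k = XV k\<close> and
  \<open>y\<^sub>k = YV k\<close> for \<open>k < g\<close>.\<close>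

datatype sympl_var = XV nat | YV nat

definition vars :: "nat \<Rightarrow> sympl_var set" where
  "vars g = XV ` {..<g} \<union> YV ` {..<g}"

definition symplectic_basis ::
    "'a::t2_space set \<Rightarrow> 'a chart set \<Rightarrow> nat \<Rightarrow> (sympl_var \<Rightarrow> real \<Rightarrow> 'a) \<Rightarrow> bool" where
  "symplectic_basis S A g c \<longleftrightarrow>
     (\<forall>v\<in>vars g. closed_curve S (c v)) \<and>
     bij_betw (\<lambda>n. \<Otimes>\<^bsub>H1 S\<^esub>v\<in>vars g. loop_class S (c v) [^]\<^bsub>H1 S\<^esub> (n v :: int))
       (vars g \<rightarrow>\<^sub>E UNIV) (carrier (H1 S)) \<and>
     (\<exists>\<omega>. intersection_form S A \<omega> \<and>
        (\<forall>i<g. \<forall>j<g.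
           \<omega> (loop_class S (c (XV i))) (loop_class S (c (XV j))) = 0 \<and>
           \<omega> (loop_class S (c (YV i))) (loop_class S (c (YV j))) = 0 \<and>
           \<omega> (loop_class S (c (XV i))) (loop_class S (c (YV j))) = (if i = j then 1 else 0)))"


section \<open>Connections and the Laurent polynomial ring\<close>

type_synonym monomial = "sympl_var \<Rightarrow>\<^sub>0 int"
type_synonym laurent = "monomial \<Rightarrow>\<^sub>0 int"

text \<open>The group ring of the free abelian group of monomials (written additively, as exponent
  vectors) in the variables \<open>vars g\<close>.\<close>

definition laurent_ring :: "nat \<Rightarrow> laurent ring" where
  "laurent_ring g =
     \<lparr>carrier = {p. \<forall>m\<in>Poly_Mapping.keys p. Poly_Mapping.keys m \<subseteq> vars g},
      mult = (*), one = 1, zero = 0, add = (+)\<rparr>"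

text \<open>In a symplectic basis a class \<open>h\<close> has \<open>x\<^sub>k\<close>-coordinate \<open>\<omega>(h, y\<^sub>k)\<close> and \<open>y\<^sub>k\<close>-coordinate
  \<open>-\<omega>(h, x\<^sub>k)\<close>; with the following signs the monomial of a closed path is its homology class.\<close>

definition path_monomial ::
    "'a::t2_space chart set \<Rightarrow> nat \<Rightarrow> (sympl_var \<Rightarrow> real \<Rightarrow> 'a) \<Rightarrow> (real \<Rightarrow> 'a) \<Rightarrow> monomial" where
  "path_monomial A g c p =
     (\<Sum>k<g. Poly_Mapping.single (XV k) (crossing_number A p (c (YV k))) +
             Poly_Mapping.single (YV k) (- crossing_number A p (c (XV k))))"

definition connection ::
    "'a::t2_space chart set \<Rightarrow> nat \<Rightarrow> (sympl_var \<Rightarrow> real \<Rightarrow> 'a) \<Rightarrow> (real \<Rightarrow> 'a) \<Rightarrow> laurent" where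
  "connection A g c p = Poly_Mapping.single (path_monomial A g c p) 1"


section \<open>Signed graphs in a surface\<close>

text \<open>Vertices and edges are abstract labels.  An undirected edge is stored with one of its two
  directions; nothing below depends on which one.\<close>

record ('v, 'e, 'a) sgraph =
  verts :: "'v set"
  edges :: "'e set"
  vpos :: "'v \<Rightarrow> 'a"
  etail :: "'e \<Rightarrow> 'v"
  ehead :: "'e \<Rightarrow> 'v"
  epath :: "'e \<Rightarrow> real \<Rightarrow> 'a"
  esign :: "'e \<Rightarrow> int"

definition admissible_path ::
    "'a::t2_space set \<Rightarrow> 'a chart set \<Rightarrow> nat \<Rightarrow> (sympl_var \<Rightarrow> real \<Rightarrow> 'a) \<Rightarrow> (real \<Rightarrow> 'a) \<Rightarrow> bool" where
  "admissible_path S A g c p \<longleftrightarrow>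
     path p \<and> path_image p \<subseteq> S \<and> (\<forall>v\<in>vars g. transverse A p (c v))"

definition signed_graph_in ::
    "'a::t2_space set \<Rightarrow> 'a chart set \<Rightarrow> nat \<Rightarrow> (sympl_var \<Rightarrow> real \<Rightarrow> 'a) \<Rightarrow> ('v, 'e, 'a) sgraph \<Rightarrow> bool"
  where
  "signed_graph_in S A g c G \<longleftrightarrow>
     finite (verts G) \<and> finite (edges G) \<and>
     (\<forall>x\<in>verts G. vpos G x \<in> S \<and> (\<forall>v\<in>vars g. vpos G x \<notin> range (c v))) \<and>
     (\<forall>e\<in>edges G. etail G e \<in> verts G \<and> ehead G e \<in> verts G \<and> esign G e \<in> {1, -1} \<and>
        admissible_path S A g c (epath G e) \<and>
        pathstart (epath G e) = vpos G (etail G e) \<and> pathfinish (epath G e) = vpos G (ehead G e))"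

text \<open>The directed edges of \<open>G\<close> are \<open>(e, True)\<close>, along the stored direction of \<open>e\<close>, and
  \<open>(e, False)\<close>, against it.\<close>

definition dedges :: "('v, 'e, 'a) sgraph \<Rightarrow> ('e \<times> bool) set" where
  "dedges G = edges G \<times> UNIV"

definition dsrc :: "('v, 'e, 'a) sgraph \<Rightarrow> 'e \<times> bool \<Rightarrow> 'v" where
  "dsrc G d = (if snd d then etail G (fst d) else ehead G (fst d))"

definition dtgt :: "('v, 'e, 'a) sgraph \<Rightarrow> 'e \<times> bool \<Rightarrow> 'v" where
  "dtgt G d = (if snd d then ehead G (fst d) else etail G (fst d))"

definition dpath :: "('v, 'e, 'a::t2_space) sgraph \<Rightarrow> 'e \<times> bool \<Rightarrow> real \<Rightarrow> 'a" where
  "dpath G d = (if snd d then epath G (fst d) else reversepath (epath G (fst d)))"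

definition dsign :: "('v, 'e, 'a) sgraph \<Rightarrow> 'e \<times> bool \<Rightarrow> int" where
  "dsign G d = esign G (fst d)"


section \<open>The Laplacian module\<close>

definition adjacency_entry ::
    "'a::t2_space chart set \<Rightarrow> nat \<Rightarrow> (sympl_var \<Rightarrow> real \<Rightarrow> 'a) \<Rightarrow> ('v, 'e, 'a) sgraph \<Rightarrow> 'v \<Rightarrow> 'v \<Rightarrow> laurent"
  where
  "adjacency_entry A g c G v w =
     (\<Sum>d | d \<in> dedges G \<and> dsrc G d = v \<and> dtgt G d = w.
        of_int (dsign G d) * connection A g c (dpath G d))"

definition signed_degree :: "('v, 'e, 'a) sgraph \<Rightarrow> 'v \<Rightarrow> int" where
  "signed_degree G v = (\<Sum>d | d \<in> dedges G \<and> dsrc G d = v. dsign G d)"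

definition laplacian_entry ::
    "'a::t2_space chart set \<Rightarrow> nat \<Rightarrow> (sympl_var \<Rightarrow> real \<Rightarrow> 'a) \<Rightarrow> ('v, 'e, 'a) sgraph \<Rightarrow> 'v \<Rightarrow> 'v \<Rightarrow> laurent"
  where
  "laplacian_entry A g c G v w =
     (if v = w then of_int (signed_degree G v) else 0) - adjacency_entry A g c G v w"

text \<open>Free module of row vectors indexed by \<open>V\<close>.  The multiplicative fields of the record play no
  role in a module.\<close>

definition free_module :: "('r, 'm) ring_scheme \<Rightarrow> 'v set \<Rightarrow> ('r, 'v \<Rightarrow> 'r) module" where
  "free_module R V =
     \<lparr>carrier = V \<rightarrow>\<^sub>E carrier R,
      mult = (\<lambda>x y. \<lambda>v\<in>V. x v \<otimes>\<^bsub>R\<^esub> y v), one = (\<lambda>v\<in>V. \<one>\<^bsub>R\<^esub>),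
      zero = (\<lambda>v\<in>V. \<zero>\<^bsub>R\<^esub>), add = (\<lambda>x y. \<lambda>v\<in>V. x v \<oplus>\<^bsub>R\<^esub> y v),
      smult = (\<lambda>a x. \<lambda>v\<in>V. a \<otimes>\<^bsub>R\<^esub> x v)\<rparr>"

definition quotient_module :: "('r, 'b, 'm) module_scheme \<Rightarrow> 'b set \<Rightarrow> ('r, 'b set) module" where
  "quotient_module M N =
     \<lparr>carrier = a_rcosets\<^bsub>M\<^esub> N, mult = undefined, one = undefined,
      zero = N, add = set_add M,
      smult = (\<lambda>a C. \<Union>x\<in>C. N +>\<^bsub>M\<^esub> (a \<odot>\<^bsub>M\<^esub> x))\<rparr>"

definition modules_isomorphic ::
    "('r, 'k) ring_scheme \<Rightarrow> ('r, 'b, 'm) module_scheme \<Rightarrow> ('r, 'c, 'n) module_scheme \<Rightarrow> bool" where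
  "modules_isomorphic R M N \<longleftrightarrow>
     (\<exists>h. bij_betw h (carrier M) (carrier N) \<and>
        (\<forall>x\<in>carrier M. \<forall>y\<in>carrier M. h (x \<oplus>\<^bsub>M\<^esub> y) = h x \<oplus>\<^bsub>N\<^esub> h y) \<and>
        (\<forall>a\<in>carrier R. \<forall>x\<in>carrier M. h (a \<odot>\<^bsub>M\<^esub> x) = a \<odot>\<^bsub>N\<^esub> h x))"

definition laplacian_module ::
    "'a::t2_space chart set \<Rightarrow> nat \<Rightarrow> (sympl_var \<Rightarrow> real \<Rightarrow> 'a) \<Rightarrow> ('v, 'e, 'a) sgraph
     \<Rightarrow> (laurent, ('v \<Rightarrow> laurent) set) module" where
  "laplacian_module A g c G =
     quotient_module (free_module (laurent_ring g) (verts G))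
       ((\<lambda>x. \<lambda>w\<in>verts G. \<Sum>v\<in>verts G. x v * laplacian_entry A g c G v w) `
          carrier (free_module (laurent_ring g) (verts G)))"


section \<open>Reidemeister graph moves\<close>

definition incident :: "('v, 'e, 'a) sgraph \<Rightarrow> 'v \<Rightarrow> 'e set" where
  "incident G v = {e \<in> edges G. etail G e = v \<or> ehead G e = v}"

definition same_edge :: "('v, 'e, 'a) sgraph \<Rightarrow> ('v, 'e, 'a) sgraph \<Rightarrow> 'e \<Rightarrow> bool" where
  "same_edge G G' e \<longleftrightarrow> etail G' e = etail G e \<and> ehead G' e = ehead G e \<and>
     epath G' e = epath G e \<and> esign G' e = esign G e"

definition unchanged ::
    "'v set \<Rightarrow> 'e set \<Rightarrow> ('v, 'e, 'a) sgraph \<Rightarrow> ('v, 'e, 'a) sgraph \<Rightarrow> bool" where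
  "unchanged V E G G' \<longleftrightarrow> (\<forall>x\<in>V. vpos G' x = vpos G x) \<and> (\<forall>e\<in>E. same_edge G G' e)"

definition move_I_vertex :: "('v, 'e, 'a) sgraph \<Rightarrow> ('v, 'e, 'a) sgraph \<Rightarrow> bool" where
  "move_I_vertex G G' \<longleftrightarrow>
     (\<exists>w e b. w \<notin> verts G \<and> e \<notin> edges G \<and>
        verts G' = insert w (verts G) \<and> edges G' = insert e (edges G) \<and>
        unchanged (verts G) (edges G) G G' \<and>
        dsrc G' (e, b) = w \<and> dtgt G' (e, b) \<in> verts G)"

definition move_I_loop ::
    "'a::t2_space set \<Rightarrow> ('v, 'e, 'a) sgraph \<Rightarrow> ('v, 'e, 'a) sgraph \<Rightarrow> bool" where
  "move_I_loop S G G' \<longleftrightarrow>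
     (\<exists>v e. v \<in> verts G \<and> e \<notin> edges G \<and>
        verts G' = verts G \<and> edges G' = insert e (edges G) \<and>
        unchanged (verts G) (edges G) G G' \<and>
        etail G' e = v \<and> ehead G' e = v \<and>
        homotopic_paths S (epath G' e) (\<lambda>_. vpos G v))"

definition move_II_parallel ::
    "'a::t2_space set \<Rightarrow> ('v, 'e, 'a) sgraph \<Rightarrow> ('v, 'e, 'a) sgraph \<Rightarrow> bool" where
  "move_II_parallel S G G' \<longleftrightarrow>
     (\<exists>e f b. e \<notin> edges G \<and> f \<notin> edges G \<and> e \<noteq> f \<and>
        verts G' = verts G \<and> edges G' = edges G \<union> {e, f} \<and>
        unchanged (verts G) (edges G) G G' \<and>
        dsrc G' (f, b) = etail G' e \<and> dtgt G' (f, b) = ehead G' e \<and>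
        homotopic_paths S (epath G' e) (dpath G' (f, b)) \<and>
        esign G' f = - esign G' e)"

text \<open>The merged vertex is called \<open>u\<close> (possibly one of the old labels) and may be placed anywhere:
  \<open>q\<close> is the trace of \<open>w\<close> during the contraction.  As the contracted edges shrink, the trace of
  \<open>v\<^sub>i\<close> is the contracted edge from \<open>v\<^sub>i\<close> to \<open>w\<close> followed by \<open>q\<close>.  An end of another edge that
  lies at \<open>v\<^sub>1\<close> or \<open>v\<^sub>2\<close> is dragged along that trace.\<close>

definition move_II_contract ::
    "'a::t2_space set \<Rightarrow> 'a chart set \<Rightarrow> nat \<Rightarrow> (sympl_var \<Rightarrow> real \<Rightarrow> 'a)
     \<Rightarrow> ('v, 'e, 'a) sgraph \<Rightarrow> ('v, 'e, 'a) sgraph \<Rightarrow> bool" where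
  "move_II_contract S A g c G G' \<longleftrightarrow>
     (\<exists>w d1 d2 u q.
        let v1 = dtgt G d1; v2 = dtgt G d2;
            V = verts G - {v1, w, v2}; E = edges G - incident G w;
            trace = (\<lambda>x. if x = v1 then reversepath (dpath G d1) +++ q
                         else reversepath (dpath G d2) +++ q);
            merge = (\<lambda>x. if x = v1 \<or> x = v2 then u else x);
            drag_tail = (\<lambda>x p. if x = v1 \<or> x = v2 then reversepath (trace x) +++ p else p);
            drag_head = (\<lambda>x p. if x = v1 \<or> x = v2 then p +++ trace x else p)
        in
        w \<in> verts G \<and> incident G w = {fst d1, fst d2} \<and> fst d1 \<noteq> fst d2 \<and>
        dsrc G d1 = w \<and> dsrc G d2 = w \<and> v1 \<noteq> w \<and> v2 \<noteq> w \<and> v1 \<noteq> v2 \<and>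
        dsign G d2 = - dsign G d1 \<and>
        u \<notin> V \<and> verts G' = insert u V \<and> edges G' = E \<and>
        admissible_path S A g c q \<and> pathstart q = vpos G w \<and> pathfinish q = vpos G' u \<and>
        unchanged V {e \<in> E. {etail G e, ehead G e} \<inter> {v1, v2} = {}} G G' \<and>
        (\<forall>e\<in>E. {etail G e, ehead G e} \<inter> {v1, v2} \<noteq> {} \<longrightarrow>
           etail G' e = merge (etail G e) \<and> ehead G' e = merge (ehead G e) \<and>
           esign G' e = esign G e \<and>
           homotopic_paths S (epath G' e)
             (drag_head (ehead G e) (drag_tail (etail G e) (epath G e)))))"

text \<open>The star consists of the directed edges \<open>d i\<close> out of \<open>v\<close>, and \<open>f i\<close> is the triangle edge
  opposite to \<open>d i\<close>, where \<open>i \<in> {0, 1, 2}\<close>.  The outer vertices need not be distinct.\<close>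

definition move_III :: "'a::t2_space set \<Rightarrow> ('v, 'e, 'a) sgraph \<Rightarrow> ('v, 'e, 'a) sgraph \<Rightarrow> bool" where
  "move_III S G G' \<longleftrightarrow>
     (\<exists>v (d :: nat \<Rightarrow> 'e \<times> bool) (f :: nat \<Rightarrow> 'e).
        let E = edges G - incident G v in
        v \<in> verts G \<and> incident G v = (\<lambda>i. fst (d i)) ` {..<3} \<and> inj_on (\<lambda>i. fst (d i)) {..<3} \<and>
        (\<forall>i<3. dsrc G (d i) = v \<and> dtgt G (d i) \<noteq> v) \<and>
        (\<exists>i<3. \<exists>j<3. dsign G (d i) \<noteq> dsign G (d j)) \<and>
        inj_on f {..<3} \<and> f ` {..<3} \<inter> E = {} \<and>
        verts G' = verts G - {v} \<and> edges G' = E \<union> f ` {..<3} \<and>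
        unchanged (verts G - {v}) E G G' \<and>
        (\<forall>i<3. let j = (i + 1) mod 3; k = (i + 2) mod 3 in
           esign G' (f i) = - dsign G (d i) \<and>
           (\<exists>b. dsrc G' (f i, b) = dtgt G (d j) \<and> dtgt G' (f i, b) = dtgt G (d k) \<and>
              homotopic_paths S (dpath G' (f i, b))
                (reversepath (dpath G (d j)) +++ dpath G (d k)))))"

definition elementary_move ::
    "'a::t2_space set \<Rightarrow> 'a chart set \<Rightarrow> nat \<Rightarrow> (sympl_var \<Rightarrow> real \<Rightarrow> 'a)
     \<Rightarrow> ('v, 'e, 'a) sgraph \<Rightarrow> ('v, 'e, 'a) sgraph \<Rightarrow> bool" where
  "elementary_move S A g c G G' \<longleftrightarrow>
     move_I_vertex G G' \<or> move_I_loop S G G' \<or> move_II_parallel S G G' \<or>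
     move_II_contract S A g c G G' \<or> move_III S G G'"

definition reidemeister_graph_move ::
    "'a::t2_space set \<Rightarrow> 'a chart set \<Rightarrow> nat \<Rightarrow> (sympl_var \<Rightarrow> real \<Rightarrow> 'a)
     \<Rightarrow> ('v, 'e, 'a) sgraph \<Rightarrow> ('v, 'e, 'a) sgraph \<Rightarrow> bool" where
  "reidemeister_graph_move S A g c G G' \<longleftrightarrow>
     elementary_move S A g c G G' \<or> elementary_move S A g c G' G"

end

theory Submission
  imports Defs
begin

text \<open>The Laplacian module is the cokernel of the Laplacian matrix, so each move has to be turned into
  an operation on matrices that does not change the cokernel.  Two operations suffice: rescaling rows
  and columns by units along a relabelling of the indices (\<open>cokernel_module_rescale\<close>), and elimination
  of a unit entry (\<open>cokernel_module_pivot\<close>): if the entry at row \<open>r\<close> and column \<open>c\<close> is a unit, then the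
  relation \<open>r\<close> expresses the generator \<open>c\<close> by the others, so both can be dropped at the price of
  passing to the Schur complement.

  The Laplacian is the sum over the edges of matrices supported on the two ends of the edge
  (\<open>laplacian_entry_eq_sum\<close>), which makes the effect of a move visible.
  \<^item> A contractible loop contributes zero, and parallel edges of opposite signs and equal
    connections cancel, so these moves do not change the matrix.
  \<^item> A new vertex of degree one has diagonal entry \<open>\<plusminus>1\<close>, and eliminating it undoes the contribution
    of its edge.
  \<^item> The centre of a star with three signs that are not all equal has diagonal entry \<open>\<plusminus>1\<close>.  The Schur
    complement there is the triangle; this is the identity \<open>star_triangle_identity\<close>, which
    rests on \<open>(s\<^sub>0 + s\<^sub>1 + s\<^sub>2) s\<^sub>i s\<^sub>j = -s\<^sub>k\<close> for such signs and distinct \<open>i, j, k\<close>.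
  \<^item> For a path \<open>v\<^sub>1, w, v\<^sub>2\<close> with opposite signs the diagonal entry at \<open>w\<close> is zero.  Rescaling every
    vertex by the monomial of its trace under the contraction makes both connections trivial, and then
    the relation \<open>w\<close> says that \<open>v\<^sub>1 = v\<^sub>2\<close>, while the relation \<open>v\<^sub>1\<close> determines \<open>w\<close>.  These
    are two successive pivots, and what remains is the matrix of the contracted graph.

  The moves prescribe the new edges only up to homotopy, whereas connections are
  defined by counting crossings.  So homotopic transverse paths must be shown to have the same
  connection (\<open>crossing_number_homotopic_paths\<close>).  If \<open>p\<close> and \<open>q\<close> are homotopic with fixed ends, then
  the loop formed by \<open>p\<close> and the reverse of \<open>q\<close> is null-homologous, and the intersection form, which
  computes the crossing numbers of loops, vanishes on it.\<close>

section \<open>Homotopic paths bound a null-homologous loop\<close>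

lemma singular_relcycle_loop:
  assumes "path p" "path_image p \<subseteq> S" "pathfinish p = pathstart p"
  shows "singular_relcycle 1 (top_of_set S) {} (frag_of (\<lambda>x\<in>standard_simplex 1. p (x 1)))"
proof -
  let ?\<sigma> = "\<lambda>x\<in>standard_simplex 1. p (x 1)"
  have coord: "continuous_map (subtopology (powertop_real UNIV) (standard_simplex 1)) (top_of_set {0..1}) (\<lambda>x. x 1)"
    by (auto simp: continuous_map_in_subtopology standard_simplex_def
        intro: continuous_map_from_subtopology continuous_map_product_projection)
  have "continuous_map (top_of_set {0..1}) (top_of_set S) p"
    using assms by (auto simp: path_def path_image_def continuous_map_in_subtopology)
  from continuous_map_compose [OF coord this]
  have "continuous_map (subtopology (powertop_real UNIV) (standard_simplex 1)) (top_of_set S) ?\<sigma>"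
    by (rule continuous_map_eq) auto
  then have simplex: "singular_simplex 1 (top_of_set S) ?\<sigma>"
    by (simp add: singular_simplex_def)
  \<comment> \<open>the two faces of the 1-simplex are the two ends of the loop\<close>
  have "singular_face 1 0 ?\<sigma> = singular_face 1 1 ?\<sigma>"
    using assms(3)
    by (auto simp: singular_face_def standard_simplex_0 simplical_face_def pathstart_def pathfinish_def
        simplical_face_in_standard_simplex standard_simplex_def intro!: restrict_ext)
  then have "chain_boundary 1 (frag_of ?\<sigma>) = 0"
    by (simp add: chain_boundary_of)
  with simplex show ?thesis
    by (simp add: singular_cycle singular_chain_of)
qed

lemma loop_class_in_carrier:
  assumes "path p" "path_image p \<subseteq> S" "pathfinish p = pathstart p"
  shows "loop_class S p \<in> carrier (H1 S)"
  using singular_relcycle_loop [OF assms] carrier_relative_homology_group [of 1 "top_of_set S" "{}"]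
  by (auto simp: loop_class_def)

text \<open>Every loop factors through the circle, by way of the argument function.  This turns statements
  about \<open>loop_class\<close> into statements about induced maps, to which the homotopy axiom applies.  Continuity
  on the circle is an assumption because for homotopic loops it comes for free from
  \<open>homotopic_loops_imp_homotopic_circlemaps\<close>.\<close>

lemma loop_class_eq_induced:
  assumes "path p" "path_image p \<subseteq> S" "pathfinish p = pathstart p"
    and cont: "continuous_on (sphere 0 1) (p \<circ> (\<lambda>z. Arg2pi z / (2 * pi)))"
  shows "loop_class S p =
    hom_induced 1 (top_of_set (sphere 0 1)) {} (top_of_set S) {} (p \<circ> (\<lambda>z. Arg2pi z / (2 * pi)))
      (loop_class (sphere 0 1) (\<lambda>t. cis (2 * pi * t)))"
proof -
  let ?f = "p \<circ> (\<lambda>z. Arg2pi z / (2 * pi))" and ?\<gamma> = "\<lambda>t. cis (2 * pi * t)"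
  have ran: "Arg2pi z / (2 * pi) \<in> {0..1}" for z
    using Arg2pi_ge_0 [of z] Arg2pi_lt_2pi [of z] by (auto simp: field_simps)
  have f: "continuous_map (top_of_set (sphere 0 1)) (top_of_set S) ?f"
    using cont assms(2) ran by (force simp: continuous_map_in_subtopology path_image_def)
  have \<gamma>: "singular_relcycle 1 (top_of_set (sphere 0 1)) {}
             (frag_of (\<lambda>x\<in>standard_simplex 1. ?\<gamma> (x 1)))"
    by (rule singular_relcycle_loop)
       (auto simp: path_def path_image_def pathstart_def pathfinish_def intro!: continuous_intros)
  have "?f (?\<gamma> t) = p t" if "t \<in> {0..1}" for t
  \<comment> \<open>at \<open>t = 1\<close> the argument jumps back to 0, which is harmless on a loop\<close>
  proof (cases "t = 1")
    case True
    then show ?thesis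
      using assms(3) Arg2pi_of_real [of 1] by (simp add: pathstart_def pathfinish_def)
  next
    case False
    then have "Arg2pi (?\<gamma> t) = 2 * pi * t"
      using that by (intro Arg2pi_unique [of 1]) (auto simp: cis_conv_exp mult_ac)
    then show ?thesis by simp
  qed
  then have "simplex_map 1 ?f (\<lambda>x\<in>standard_simplex 1. ?\<gamma> (x 1)) = (\<lambda>x\<in>standard_simplex 1. p (x 1))"
    by (auto simp: simplex_map_def standard_simplex_def fun_eq_iff)
  then show ?thesis
    using hom_induced_chain_map [OF f _ \<gamma>, of "{}"] by (simp add: loop_class_def)
qed

lemma loop_class_homotopic_loops:
  assumes "homotopic_loops S p q"
  shows "loop_class S p = loop_class S q"
proof -
  let ?arg = "\<lambda>z. Arg2pi z / (2 * pi)"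
  have hom: "homotopic_with_canon (\<lambda>h. True) (sphere 0 1) S (p \<circ> ?arg) (q \<circ> ?arg)"
    by (rule homotopic_loops_imp_homotopic_circlemaps [OF assms])
  have "loop_class S r =
      hom_induced 1 (top_of_set (sphere 0 1)) {} (top_of_set S) {} (r \<circ> ?arg)
        (loop_class (sphere 0 1) (\<lambda>t. cis (2 * pi * t)))" if "r = p \<or> r = q" for r
    using that homotopic_loops_imp_path [OF assms] homotopic_loops_imp_loop [OF assms]
      homotopic_loops_imp_subset [OF assms] homotopic_with_imp_continuous [OF hom]
    by (intro loop_class_eq_induced) auto
  moreover have "hom_induced 1 (top_of_set (sphere 0 1)) {} (top_of_set S) {} (p \<circ> ?arg) =
      hom_induced 1 (top_of_set (sphere 0 1)) {} (top_of_set S) {} (q \<circ> ?arg)"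
    using hom by (intro homology_homotopy_axiom) simp
  ultimately show ?thesis by simp
qed

text \<open>A constant loop lies in a one-point space, where every 1-cycle is a boundary.\<close>

lemma loop_class_const:
  assumes "a \<in> S"
  shows "loop_class S (\<lambda>_. a) = \<one>\<^bsub>H1 S\<^esub>"
proof -
  let ?c = "frag_of (\<lambda>x\<in>standard_simplex 1. a)"
  have "singular_relcycle 1 (top_of_set {a}) {} ?c"
    using singular_relcycle_loop [of "\<lambda>_. a" "{a}"]
    by (auto simp: path_def path_image_def pathstart_def pathfinish_def)
  then have "singular_relboundary 1 (top_of_set {a}) {} ?c"
    by (simp add: singular_boundary_eq_cycle_singleton [of _ a])
  then have "singular_relboundary 1 (top_of_set S) {} ?c"
    using assms by (auto intro: singular_boundary_mono)
  then show ?thesis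
    using one_relative_homology_group [of 1 "top_of_set S" "{}"]
    by (simp add: loop_class_def homologous_rel_set_eq_relboundary)
qed

text \<open>The path retreats along itself: at time \<open>s\<close> only the initial part of \<open>p\<close> up to parameter \<open>s\<close> is
  traversed, forth and back.\<close>

lemma homotopic_loops_join_reversepath:
  assumes "path p" "path_image p \<subseteq> S"
  shows "homotopic_loops S (\<lambda>_. pathstart p) (p +++ reversepath p)"
proof -
  let ?h = "\<lambda>w. p (fst w * (1 - \<bar>2 * snd w - 1\<bar>))"
  have ran: "fst w * (1 - \<bar>2 * snd w - 1\<bar>) \<in> {0..1::real}" if "w \<in> {0..1} \<times> {0..1}" for w :: "real \<times> real"
    using that by (auto simp: mult_le_one abs_if)
  have "continuous_on ({0..1} \<times> {0..1}) ?h"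
    using assms(1) unfolding path_def
    by (rule continuous_on_compose2) (use ran in \<open>auto intro!: continuous_intros\<close>)
  moreover have "?h \<in> {0..1} \<times> {0..1} \<rightarrow> S"
    using ran assms(2) by (fastforce simp: path_image_def)
  ultimately show ?thesis
    unfolding homotopic_loops
    apply (intro exI [of _ ?h])
    apply (auto simp: pathstart_def pathfinish_def joinpaths_def reversepath_def abs_if field_simps)
    done
qed

lemma loop_class_homotopic_paths:
  assumes "homotopic_paths S p q"
  shows "loop_class S (p +++ reversepath q) = \<one>\<^bsub>H1 S\<^esub>"
proof -
  have p: "path p" "path_image p \<subseteq> S"
    using assms homotopic_paths_imp_path homotopic_paths_imp_subset by blast+
  have "homotopic_paths S (p +++ reversepath q) (p +++ reversepath p)"
    using assms p homotopic_paths_imp_pathfinish [OF assms]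
    by (intro homotopic_paths_join) (auto simp: homotopic_paths_reversepath homotopic_paths_sym)
  then have "homotopic_loops S (p +++ reversepath q) (p +++ reversepath p)"
    using homotopic_paths_imp_pathstart [OF assms]
    by (intro homotopic_paths_imp_homotopic_loops) auto
  then have "homotopic_loops S (p +++ reversepath q) (\<lambda>_. pathstart p)"
    using homotopic_loops_join_reversepath [OF p] homotopic_loops_sym homotopic_loops_trans by blast
  from loop_class_homotopic_loops [OF this] show ?thesis
    using loop_class_const p by (metis pathstart_in_path_image subsetD)
qed

section \<open>Crossing numbers along composed, reversed and homotopic paths\<close>

text \<open>Joining and reversing reparametrise a path affinely near each parameter value, which multiplies
  velocities by the slope.\<close>

lemma has_vector_derivative_reparam_iff:
  fixes p r :: "real \<Rightarrow> 'a" and f :: "'a \<Rightarrow> 'b::real_normed_vector"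
  assumes "k \<noteq> 0" and near: "\<forall>\<^sub>F t' in nhds t. r t' = p (k * t' + b)"
  shows "(f \<circ> r has_vector_derivative k *\<^sub>R u) (at t) \<longleftrightarrow> (f \<circ> p has_vector_derivative u) (at (k * t + b))"
proof -
  have "(f \<circ> r has_vector_derivative k *\<^sub>R u) (at t) \<longleftrightarrow>
      ((\<lambda>t'. (f \<circ> p) (k * t' + b)) has_vector_derivative k *\<^sub>R u) (at t)"
    using near eventually_nhds_x_imp_x [OF near]
    by (intro has_vector_derivative_cong_ev) (auto elim!: eventually_mono)
  also have "\<dots> \<longleftrightarrow> (f \<circ> p has_vector_derivative u) (at (k * t + b))"
  proof
    assume L: "((\<lambda>t'. (f \<circ> p) (k * t' + b)) has_vector_derivative k *\<^sub>R u) (at t)"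
    have "((\<lambda>s. (s - b) / k) has_vector_derivative 1 / k) (at (k * t + b))"
      using assms(1) by (auto intro!: derivative_eq_intros simp: has_real_derivative_iff_has_vector_derivative [symmetric])
    from vector_diff_chain_at [OF this, of "\<lambda>t'. (f \<circ> p) (k * t' + b)" "k *\<^sub>R u"] L assms(1)
    show "(f \<circ> p has_vector_derivative u) (at (k * t + b))"
      by (simp add: o_def)
  next
    assume R: "(f \<circ> p has_vector_derivative u) (at (k * t + b))"
    have "((\<lambda>t'. k * t' + b) has_vector_derivative k) (at t)"
      by (auto intro!: derivative_eq_intros simp: has_real_derivative_iff_has_vector_derivative [symmetric])
    from vector_diff_chain_at [OF this R] show "((\<lambda>t'. (f \<circ> p) (k * t' + b)) has_vector_derivative k *\<^sub>R u) (at t)"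
      by (simp add: o_def)
  qed
  finally show ?thesis .
qed

lemma crossing_condition_reparam:
  assumes "k \<noteq> 0" and near: "\<forall>\<^sub>F t' in nhds t. r t' = p (k * t' + b)"
  shows "(\<exists>(U,f)\<in>A. r t \<in> U \<and>
           (\<exists>u v. (f \<circ> r has_vector_derivative u) (at t) \<and> (f \<circ> c has_vector_derivative v) (at s) \<and>
             sgn (det (vector [u, v] :: real^2^2)) = sgn k * \<epsilon>)) \<longleftrightarrow>
         (\<exists>(U,f)\<in>A. p (k * t + b) \<in> U \<and>
           (\<exists>u v. (f \<circ> p has_vector_derivative u) (at (k * t + b)) \<and> (f \<circ> c has_vector_derivative v) (at s) \<and>
             sgn (det (vector [u, v] :: real^2^2)) = \<epsilon>))"
proof -
  have det: "sgn (det (vector [k *\<^sub>R u, v] :: real^2^2)) = sgn k * \<epsilon> \<longleftrightarrow>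
      sgn (det (vector [u, v] :: real^2^2)) = \<epsilon>" for u v
  proof -
    have "det (vector [k *\<^sub>R u, v] :: real^2^2) = k * det (vector [u, v] :: real^2^2)"
      by (simp add: det_2 algebra_simps)
    then show ?thesis using assms(1) by (simp add: sgn_mult sgn_eq_0_iff)
  qed
  have eq: "(\<exists>u. (f \<circ> r has_vector_derivative u) (at t) \<and> Q u) \<longleftrightarrow>
      (\<exists>u. (f \<circ> p has_vector_derivative u) (at (k * t + b)) \<and> Q (k *\<^sub>R u))" for f :: "'a \<Rightarrow> real^2" and Q
  proof
    assume "\<exists>u. (f \<circ> r has_vector_derivative u) (at t) \<and> Q u"
    then obtain u where u: "(f \<circ> r has_vector_derivative k *\<^sub>R ((1/k) *\<^sub>R u)) (at t)" "Q (k *\<^sub>R ((1/k) *\<^sub>R u))"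
      using assms(1) by auto
    from u(1) have "(f \<circ> p has_vector_derivative (1/k) *\<^sub>R u) (at (k * t + b))"
      by (simp only: has_vector_derivative_reparam_iff [OF assms])
    with u(2) show "\<exists>u. (f \<circ> p has_vector_derivative u) (at (k * t + b)) \<and> Q (k *\<^sub>R u)"
      by blast
  next
    assume "\<exists>u. (f \<circ> p has_vector_derivative u) (at (k * t + b)) \<and> Q (k *\<^sub>R u)"
    then obtain u where "(f \<circ> p has_vector_derivative u) (at (k * t + b))" "Q (k *\<^sub>R u)" by blast
    then show "\<exists>u. (f \<circ> r has_vector_derivative u) (at t) \<and> Q u"
      using has_vector_derivative_reparam_iff [OF assms] by blast
  qed
  have "(\<exists>u v. (f \<circ> r has_vector_derivative u) (at t) \<and> (f \<circ> c has_vector_derivative v) (at s) \<and>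
             sgn (det (vector [u, v] :: real^2^2)) = sgn k * \<epsilon>) \<longleftrightarrow>
      (\<exists>u v. (f \<circ> p has_vector_derivative u) (at (k * t + b)) \<and> (f \<circ> c has_vector_derivative v) (at s) \<and>
             sgn (det (vector [u, v] :: real^2^2)) = \<epsilon>)" for f :: "'a \<Rightarrow> real^2"
    using eq [of f "\<lambda>u. \<exists>v. (f \<circ> c has_vector_derivative v) (at s) \<and>
             sgn (det (vector [u, v] :: real^2^2)) = sgn k * \<epsilon>"]
    by (simp only: det ex_simps)
  moreover have "r t = p (k * t + b)"
    by (rule eventually_nhds_x_imp_x [OF near])
  ultimately show ?thesis by simp
qed

lemma crossings_subset_meetings: "crossings A \<epsilon> p c \<subseteq> meetings p c"
  by (auto simp: crossings_def)

lemma mem_image_reparam_iff: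
  fixes h h' :: "real \<Rightarrow> real" and X :: "(real \<times> real) set"
  assumes "\<And>t. h (h' t) = t" "\<And>t. h' (h t) = t"
  shows "(t, s) \<in> (\<lambda>(t,s). (h t, s)) ` X \<longleftrightarrow> (h' t, s) \<in> X"
proof
  assume "(h' t, s) \<in> X"
  then have "(\<lambda>(t,s). (h t, s)) (h' t, s) \<in> (\<lambda>(t,s). (h t, s)) ` X" by (rule imageI)
  then show "(t, s) \<in> (\<lambda>(t,s). (h t, s)) ` X" by (simp add: assms)
qed (auto simp: assms)

text \<open>A negative slope exchanges positive and negative crossings.\<close>

lemma crossings_reparam_iff:
  assumes "k \<noteq> 0" "\<forall>\<^sub>F t' in nhds t. r t' = p (k * t' + b)"
    and "t \<in> {0..1} \<longleftrightarrow> k * t + b \<in> {0..1}"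
  shows "(t, s) \<in> crossings A (sgn k * \<epsilon>) r c \<longleftrightarrow> (k * t + b, s) \<in> crossings A \<epsilon> p c"
proof -
  have "r t = p (k * t + b)"
    by (rule eventually_nhds_x_imp_x [OF assms(2)])
  then show ?thesis
    unfolding crossings_def meetings_def mem_Collect_eq prod.case
      crossing_condition_reparam [OF assms(1,2)] by (simp only: assms(3))
qed

lemma crossings_reversepath:
  "crossings A \<epsilon> (reversepath p) c = (\<lambda>(t,s). (1 - t, s)) ` crossings A (-\<epsilon>) p c"
proof (unfold set_eq_iff split_paired_All, intro allI)
  fix t s :: real
  have "\<forall>\<^sub>F t' in nhds t. reversepath p t' = p (- 1 * t' + 1)"
    by (simp add: reversepath_def)
  from crossings_reparam_iff [OF _ this, of s A "-\<epsilon>" c]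
  have "(t, s) \<in> crossings A \<epsilon> (reversepath p) c \<longleftrightarrow> (1 - t, s) \<in> crossings A (-\<epsilon>) p c"
    by (simp add: conj_commute)
  then show "(t, s) \<in> crossings A \<epsilon> (reversepath p) c \<longleftrightarrow>
      (t, s) \<in> (\<lambda>(t,s). (1 - t, s)) ` crossings A (-\<epsilon>) p c"
    by (subst mem_image_reparam_iff [where h' = "\<lambda>t. 1 - t"]) auto
qed

lemma meetings_reversepath: "meetings (reversepath p) c = (\<lambda>(t,s). (1 - t, s)) ` meetings p c"
proof (unfold set_eq_iff split_paired_All, intro allI)
  fix t s
  show "(t, s) \<in> meetings (reversepath p) c \<longleftrightarrow> (t, s) \<in> (\<lambda>(t,s). (1 - t, s)) ` meetings p c"
    by (subst mem_image_reparam_iff [where h' = "\<lambda>t. 1 - t"]) (auto simp: meetings_def reversepath_def)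
qed

lemma crossing_number_reversepath: "crossing_number A (reversepath p) c = - crossing_number A p c"
proof -
  have "inj_on (\<lambda>(t::real,s::real). (1 - t, s)) X" for X
    by (auto simp: inj_on_def)
  then show ?thesis
    by (simp add: crossing_number_def crossings_reversepath card_image)
qed

lemma transverse_reversepath:
  assumes "transverse A p c"
  shows "transverse A (reversepath p) c"
  using assms unfolding transverse_def crossings_reversepath meetings_reversepath
  by auto

text \<open>At the junction the velocity need not exist, so it matters that this point is off the curve.\<close>

lemma crossings_joinpaths:
  assumes "pathfinish p = pathstart q" "pathfinish p \<notin> range c"
  shows "crossings A \<epsilon> (p +++ q) c =
    (\<lambda>(t,s). (t / 2, s)) ` crossings A \<epsilon> p c \<union> (\<lambda>(t,s). ((t + 1) / 2, s)) ` crossings A \<epsilon> q c"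
proof (unfold set_eq_iff split_paired_All, intro allI)
  fix t s :: real
  have end_p: "(1, s) \<notin> crossings A \<epsilon> p c" and end_q: "(0, s) \<notin> crossings A \<epsilon> q c" for s
    using assms by (auto simp: crossings_def meetings_def pathstart_def pathfinish_def)
  let ?R = "(\<lambda>(t,s). (t / 2, s)) ` crossings A \<epsilon> p c \<union> (\<lambda>(t,s). ((t + 1) / 2, s)) ` crossings A \<epsilon> q c"
  have R: "(t, s) \<in> ?R \<longleftrightarrow> (2 * t, s) \<in> crossings A \<epsilon> p c \<or> (2 * t - 1, s) \<in> crossings A \<epsilon> q c"
    using mem_image_reparam_iff [of "\<lambda>t. t / 2" "\<lambda>t. 2 * t" t s "crossings A \<epsilon> p c"]
      mem_image_reparam_iff [of "\<lambda>t. (t + 1) / 2" "\<lambda>t. 2 * t - 1" t s "crossings A \<epsilon> q c"]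
    by (simp add: add_divide_distrib)
  have ran: "x \<in> {0..1}" if "(x, s) \<in> crossings A \<epsilon> r c" for x r
    using that by (auto simp: crossings_def meetings_def)
  consider "t < 1/2" | "t = 1/2" | "t > 1/2" by linarith
  then show "(t, s) \<in> crossings A \<epsilon> (p +++ q) c \<longleftrightarrow> (t, s) \<in> ?R"
  proof cases
    case 1
    have "\<forall>\<^sub>F t' in nhds t. t' \<in> {..<1/2}"
      using 1 by (intro eventually_nhds_in_open) auto
    then have "\<forall>\<^sub>F t' in nhds t. (p +++ q) t' = p (2 * t' + 0)"
      by (rule eventually_mono) (simp add: joinpaths_def)
    from crossings_reparam_iff [OF _ this, of s A \<epsilon> c] 1
    have "(t, s) \<in> crossings A \<epsilon> (p +++ q) c \<longleftrightarrow> (2 * t, s) \<in> crossings A \<epsilon> p c"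
      by simp
    moreover have "(2 * t - 1, s) \<notin> crossings A \<epsilon> q c"
      using ran [of "2 * t - 1" q] 1 by auto
    ultimately show ?thesis using R by blast
  next
    case 2
    have "(p +++ q) (1/2) = pathfinish p"
      by (simp add: joinpaths_def pathfinish_def)
    then have "(p +++ q) t = pathfinish p"
      by (simp only: 2)
    then have "(t, s) \<notin> crossings A \<epsilon> (p +++ q) c"
      using assms(2) by (auto simp: crossings_def meetings_def)
    moreover have "(t, s) \<notin> ?R"
      using R end_p [of s] end_q [of s] by (simp add: 2)
    ultimately show ?thesis by blast
  next
    case 3
    have "\<forall>\<^sub>F t' in nhds t. t' \<in> {1/2<..}"
      using 3 by (intro eventually_nhds_in_open) auto
    then have "\<forall>\<^sub>F t' in nhds t. (p +++ q) t' = q (2 * t' + (-1))"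
      by (rule eventually_mono) (simp add: joinpaths_def)
    from crossings_reparam_iff [OF _ this, of s A \<epsilon> c] 3
    have "(t, s) \<in> crossings A \<epsilon> (p +++ q) c \<longleftrightarrow> (2 * t - 1, s) \<in> crossings A \<epsilon> q c"
      by simp
    moreover have "(2 * t, s) \<notin> crossings A \<epsilon> p c"
      using ran [of "2 * t" p] 3 by auto
    ultimately show ?thesis using R by blast
  qed
qed

lemma meetings_joinpaths_subset:
  assumes "pathfinish p = pathstart q"
  shows "meetings (p +++ q) c \<subseteq>
    (\<lambda>(t,s). (t / 2, s)) ` meetings p c \<union> (\<lambda>(t,s). ((t + 1) / 2, s)) ` meetings q c"
proof (unfold subset_iff split_paired_All, intro allI impI)
  fix t s
  assume "(t, s) \<in> meetings (p +++ q) c"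
  then have "(2 * t, s) \<in> meetings p c \<or> (2 * t - 1, s) \<in> meetings q c"
    by (auto simp: meetings_def joinpaths_def split: if_splits)
  then show "(t, s) \<in> (\<lambda>(t,s). (t / 2, s)) ` meetings p c \<union> (\<lambda>(t,s). ((t + 1) / 2, s)) ` meetings q c"
    using mem_image_reparam_iff [of "\<lambda>t. t / 2" "\<lambda>t. 2 * t" t s "meetings p c"]
      mem_image_reparam_iff [of "\<lambda>t. (t + 1) / 2" "\<lambda>t. 2 * t - 1" t s "meetings q c"]
    by (simp add: add_divide_distrib)
qed

lemma transverse_joinpaths:
  assumes "pathfinish p = pathstart q" "transverse A p c" "transverse A q c"
  shows "transverse A (p +++ q) c"
proof -
  let ?l = "\<lambda>(t::real,s::real). (t / 2, s)" and ?r = "\<lambda>(t::real,s::real). ((t + 1) / 2, s)"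
  have p: "finite (meetings p c)" "meetings p c \<subseteq> crossings A 1 p c \<union> crossings A (-1) p c"
    and q: "finite (meetings q c)" "meetings q c \<subseteq> crossings A 1 q c \<union> crossings A (-1) q c"
    and off: "pathfinish p \<notin> range c"
    using assms by (auto simp: transverse_def)
  note sub = meetings_joinpaths_subset [OF assms(1), of c]
  have "finite (meetings (p +++ q) c)"
    by (rule finite_subset [OF sub]) (use p(1) q(1) in simp)
  moreover have "meetings (p +++ q) c \<subseteq> crossings A 1 (p +++ q) c \<union> crossings A (-1) (p +++ q) c"
    using subset_trans [OF sub Un_mono [OF image_mono [OF p(2), of ?l] image_mono [OF q(2), of ?r]]]
    unfolding crossings_joinpaths [OF assms(1) off] by blast
  ultimately show ?thesis
    using assms by (simp add: transverse_def)
qed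

lemma crossing_number_joinpaths:
  assumes "pathfinish p = pathstart q" "transverse A p c" "transverse A q c"
  shows "crossing_number A (p +++ q) c = crossing_number A p c + crossing_number A q c"
proof -
  have off: "pathfinish p \<notin> range c"
    using assms by (auto simp: transverse_def)
  have fin: "finite (crossings A \<epsilon> p c)" "finite (crossings A \<epsilon> q c)" for \<epsilon>
    using assms(2,3) finite_subset [OF crossings_subset_meetings] by (auto simp: transverse_def)
  have "card (crossings A \<epsilon> (p +++ q) c) = card (crossings A \<epsilon> p c) + card (crossings A \<epsilon> q c)" for \<epsilon>
  proof -
    let ?P = "(\<lambda>(t,s). (t / 2, s)) ` crossings A \<epsilon> p c" and ?Q = "(\<lambda>(t,s). ((t + 1) / 2, s)) ` crossings A \<epsilon> q c"
    have "(0, s) \<notin> crossings A \<epsilon> q c" for s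
      using assms(1) off by (auto simp: crossings_def meetings_def pathstart_def pathfinish_def)
    then have "?P \<inter> ?Q = {}"
      by (fastforce simp: crossings_def meetings_def)
    then have "card (?P \<union> ?Q) = card ?P + card ?Q"
      using fin by (intro card_Un_disjoint) auto
    also have "card ?P = card (crossings A \<epsilon> p c)"
      by (rule card_image) (auto simp: inj_on_def)
    also have "card ?Q = card (crossings A \<epsilon> q c)"
      by (rule card_image) (auto simp: inj_on_def)
    finally show ?thesis
      by (simp add: crossings_joinpaths [OF assms(1) off])
  qed
  then show ?thesis
    by (simp add: crossing_number_def)
qed

text \<open>The form is additive, and it is this that kills the trivial class: \<open>\<omega>(1, d) = \<omega>(1, d) + \<omega>(1, d)\<close>.\<close>

lemma intersection_form_one_left:
  assumes "intersection_form S A \<omega>" "d \<in> carrier (H1 S)"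
  shows "\<omega> \<one>\<^bsub>H1 S\<^esub> d = 0"
proof -
  interpret H: group "H1 S" by simp
  have "\<omega> (\<one>\<^bsub>H1 S\<^esub> \<otimes>\<^bsub>H1 S\<^esub> \<one>\<^bsub>H1 S\<^esub>) d = \<omega> \<one>\<^bsub>H1 S\<^esub> d + \<omega> \<one>\<^bsub>H1 S\<^esub> d"
    using assms(1) [unfolded intersection_form_def, THEN conjunct1, rule_format,
        OF H.one_closed H.one_closed assms(2)] by (rule conjunct1)
  then show ?thesis by (simp only: H.l_one [OF H.one_closed])
qed

lemma loop_class_closed_curve:
  assumes "closed_curve S c"
  shows "loop_class S c \<in> carrier (H1 S)"
proof (rule loop_class_in_carrier)
  show "path c" "path_image c \<subseteq> S"
    using assms continuous_on_subset by (auto simp: closed_curve_def path_def path_image_def)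
  show "pathfinish c = pathstart c"
    using assms by (metis add.left_neutral closed_curve_def pathfinish_def pathstart_def)
qed

text \<open>Crossing numbers of paths that are not closed are not homological, but the difference of two of
  them with common ends is the crossing number of a loop.\<close>

lemma crossing_number_homotopic_paths:
  assumes \<omega>: "intersection_form S A \<omega>" and c: "closed_curve S c"
    and hom: "homotopic_paths S p q" and p: "transverse A p c" and q: "transverse A q c"
  shows "crossing_number A p c = crossing_number A q c"
proof -
  let ?l = "p +++ reversepath q"
  have ends: "pathstart p = pathstart q" "pathfinish p = pathfinish q"
    using hom homotopic_paths_imp_pathstart homotopic_paths_imp_pathfinish by blast+
  have paths: "path p" "path q" "path_image p \<subseteq> S" "path_image q \<subseteq> S"
    using hom homotopic_paths_imp_path homotopic_paths_imp_subset by blast+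
  have l: "path ?l" "path_image ?l \<subseteq> S" "pathfinish ?l = pathstart ?l" "transverse A ?l c"
    using ends paths p q
    by (auto simp: subset_path_image_join intro!: transverse_joinpaths transverse_reversepath)
  then have "crossing_number A ?l c = \<omega> (loop_class S ?l) (loop_class S c)"
    using \<omega> c unfolding intersection_form_def by metis
  also have "\<dots> = 0"
    using intersection_form_one_left [OF \<omega> loop_class_closed_curve [OF c]]
      loop_class_homotopic_paths [OF hom] by simp
  finally show ?thesis
    using ends p q
    by (simp add: crossing_number_joinpaths transverse_reversepath crossing_number_reversepath)
qed

section \<open>Isomorphisms between quotient modules\<close>

lemma modules_isomorphic_refl: "modules_isomorphic R M M"
  unfolding modules_isomorphic_def by (rule exI [of _ "\<lambda>x. x"]) (auto simp: bij_betw_def)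

lemma modules_isomorphic_trans:
  assumes "modules_isomorphic R M N" "modules_isomorphic R N P"
  shows "modules_isomorphic R M P"
proof -
  obtain h k where h: "bij_betw h (carrier M) (carrier N)"
      "\<forall>x\<in>carrier M. \<forall>y\<in>carrier M. h (x \<oplus>\<^bsub>M\<^esub> y) = h x \<oplus>\<^bsub>N\<^esub> h y"
      "\<forall>a\<in>carrier R. \<forall>x\<in>carrier M. h (a \<odot>\<^bsub>M\<^esub> x) = a \<odot>\<^bsub>N\<^esub> h x"
    and k: "bij_betw k (carrier N) (carrier P)"
      "\<forall>x\<in>carrier N. \<forall>y\<in>carrier N. k (x \<oplus>\<^bsub>N\<^esub> y) = k x \<oplus>\<^bsub>P\<^esub> k y"
      "\<forall>a\<in>carrier R. \<forall>x\<in>carrier N. k (a \<odot>\<^bsub>N\<^esub> x) = a \<odot>\<^bsub>P\<^esub> k x"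
    using assms unfolding modules_isomorphic_def by blast
  then show ?thesis
    unfolding modules_isomorphic_def
    by (intro exI [of _ "k \<circ> h"]) (auto simp: bij_betw_trans dest: bij_betwE)
qed

text \<open>Without closure of \<open>M\<close> under the operations, injectivity on the carrier would say nothing about
  the values of the inverse at sums and multiples.\<close>

lemma modules_isomorphic_sym:
  assumes iso: "modules_isomorphic R M N"
    and add: "\<And>x y. x \<in> carrier M \<Longrightarrow> y \<in> carrier M \<Longrightarrow> x \<oplus>\<^bsub>M\<^esub> y \<in> carrier M"
    and smult: "\<And>a x. a \<in> carrier R \<Longrightarrow> x \<in> carrier M \<Longrightarrow> a \<odot>\<^bsub>M\<^esub> x \<in> carrier M"
  shows "modules_isomorphic R N M"
proof -
  obtain h where h: "bij_betw h (carrier M) (carrier N)"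
      "\<forall>x\<in>carrier M. \<forall>y\<in>carrier M. h (x \<oplus>\<^bsub>M\<^esub> y) = h x \<oplus>\<^bsub>N\<^esub> h y"
      "\<forall>a\<in>carrier R. \<forall>x\<in>carrier M. h (a \<odot>\<^bsub>M\<^esub> x) = a \<odot>\<^bsub>N\<^esub> h x"
    using iso unfolding modules_isomorphic_def by blast
  let ?k = "the_inv_into (carrier M) h"
  have k: "?k x \<in> carrier M" "h (?k x) = x" if "x \<in> carrier N" for x
    using h(1) that by (auto simp: bij_betw_def the_inv_into_into f_the_inv_into_f)
  have kh: "?k (h x) = x" if "x \<in> carrier M" for x
    using h(1) that by (auto simp: bij_betw_def the_inv_into_f_f)
  have "?k (x \<oplus>\<^bsub>N\<^esub> y) = ?k x \<oplus>\<^bsub>M\<^esub> ?k y" if "x \<in> carrier N" "y \<in> carrier N" for x y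
    using kh [of "?k x \<oplus>\<^bsub>M\<^esub> ?k y"] k that h(2) add by simp
  moreover have "?k (a \<odot>\<^bsub>N\<^esub> x) = a \<odot>\<^bsub>M\<^esub> ?k x" if "a \<in> carrier R" "x \<in> carrier N" for a x
    using kh [of "a \<odot>\<^bsub>M\<^esub> ?k x"] k that h(3) smult by simp
  ultimately show ?thesis
    unfolding modules_isomorphic_def using bij_betw_the_inv_into [OF h(1)] by blast
qed

lemma (in module) submodule_imp_abelian_subgroup:
  assumes "submodule N R M"
  shows "abelian_subgroup N M"
  using assms
  by (intro abelian_subgroupI3 additive_subgroupI abelian_group_axioms) (rule submodule.axioms)

text \<open>Negatives are multiples by \<open>-1\<close>.\<close>

lemma (in module) submoduleI_smult:
  assumes "H \<subseteq> carrier M" "\<zero>\<^bsub>M\<^esub> \<in> H"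
    and "\<And>x y. x \<in> H \<Longrightarrow> y \<in> H \<Longrightarrow> x \<oplus>\<^bsub>M\<^esub> y \<in> H"
    and "\<And>a x. a \<in> carrier R \<Longrightarrow> x \<in> H \<Longrightarrow> a \<odot>\<^bsub>M\<^esub> x \<in> H"
  shows "submodule H R M"
proof (rule submoduleI)
  show "\<ominus>\<^bsub>M\<^esub> x \<in> H" if "x \<in> H" for x
    using assms(4) [of "\<ominus> \<one>" x] smult_l_minus [of \<one> x] assms(1) that by auto
qed (use assms in auto)

lemma (in module) quotient_module_smult:
  assumes N: "submodule N R M" and a: "a \<in> carrier R" and x: "x \<in> carrier M"
  shows "a \<odot>\<^bsub>quotient_module M N\<^esub> (N +>\<^bsub>M\<^esub> x) = N +>\<^bsub>M\<^esub> (a \<odot>\<^bsub>M\<^esub> x)"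
proof -
  interpret N: abelian_subgroup N M by (rule submodule_imp_abelian_subgroup [OF N])
  have "N +>\<^bsub>M\<^esub> (a \<odot>\<^bsub>M\<^esub> y) = N +>\<^bsub>M\<^esub> (a \<odot>\<^bsub>M\<^esub> x)" if y: "y \<in> N +>\<^bsub>M\<^esub> x" for y
  proof -
    obtain n where n: "n \<in> N" "y = n \<oplus>\<^bsub>M\<^esub> x"
      using y by (auto simp: a_r_coset_def')
    then have "a \<odot>\<^bsub>M\<^esub> y = a \<odot>\<^bsub>M\<^esub> n \<oplus>\<^bsub>M\<^esub> a \<odot>\<^bsub>M\<^esub> x" "a \<odot>\<^bsub>M\<^esub> n \<in> N"
      using a x N by (auto simp: smult_r_distr submodule.smult_closed)
    then have "a \<odot>\<^bsub>M\<^esub> y \<in> N +>\<^bsub>M\<^esub> (a \<odot>\<^bsub>M\<^esub> x)"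
      by (auto simp: a_r_coset_def')
    then show ?thesis
      using N.a_repr_independence' a x by (metis smult_closed)
  qed
  then have "(\<Union>y\<in>N +>\<^bsub>M\<^esub> x. N +>\<^bsub>M\<^esub> (a \<odot>\<^bsub>M\<^esub> y)) = (\<Union>y\<in>N +>\<^bsub>M\<^esub> x. N +>\<^bsub>M\<^esub> (a \<odot>\<^bsub>M\<^esub> x))"
    by (rule SUP_cong [OF refl])
  also have "\<dots> = N +>\<^bsub>M\<^esub> (a \<odot>\<^bsub>M\<^esub> x)"
    using N.a_rcos_self [OF x] by blast
  finally show ?thesis
    by (simp add: quotient_module_def)
qed

lemma (in module) quotient_module_closed:
  assumes N: "submodule N R M"
  shows "\<And>X Y. X \<in> carrier (quotient_module M N) \<Longrightarrow> Y \<in> carrier (quotient_module M N) \<Longrightarrow>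
           X \<oplus>\<^bsub>quotient_module M N\<^esub> Y \<in> carrier (quotient_module M N)"
    and "\<And>a X. a \<in> carrier R \<Longrightarrow> X \<in> carrier (quotient_module M N) \<Longrightarrow>
           a \<odot>\<^bsub>quotient_module M N\<^esub> X \<in> carrier (quotient_module M N)"
proof -
  interpret N: abelian_subgroup N M by (rule submodule_imp_abelian_subgroup [OF N])
  show "X \<oplus>\<^bsub>quotient_module M N\<^esub> Y \<in> carrier (quotient_module M N)"
    if "X \<in> carrier (quotient_module M N)" "Y \<in> carrier (quotient_module M N)" for X Y
    using that by (simp add: quotient_module_def N.a_setmult_closed)
  show "a \<odot>\<^bsub>quotient_module M N\<^esub> X \<in> carrier (quotient_module M N)"
    if aX: "a \<in> carrier R" "X \<in> carrier (quotient_module M N)" for a X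
  proof -
    obtain x where "x \<in> carrier M" "X = N +>\<^bsub>M\<^esub> x"
      using aX(2) by (auto simp: quotient_module_def A_RCOSETS_def')
    then show ?thesis
      using aX(1) quotient_module_smult [OF N]
      by (auto simp: quotient_module_def A_RCOSETS_def')
  qed
qed

text \<open>The first isomorphism theorem in the form in which it is used for presentations: \<open>\<phi>\<close> maps cosets
  of \<open>N\<close> onto cosets of \<open>N'\<close>, and distinct cosets stay distinct because \<open>N\<close> is the full preimage of \<open>N'\<close>.\<close>

lemma quotient_modules_isomorphic:
  assumes M: "module R M" and M': "module R M'" and N: "submodule N R M" and N': "submodule N' R M'"
    and add: "\<And>x y. x \<in> carrier M \<Longrightarrow> y \<in> carrier M \<Longrightarrow> \<phi> (x \<oplus>\<^bsub>M\<^esub> y) = \<phi> x \<oplus>\<^bsub>M'\<^esub> \<phi> y"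
    and smult: "\<And>a x. a \<in> carrier R \<Longrightarrow> x \<in> carrier M \<Longrightarrow> \<phi> (a \<odot>\<^bsub>M\<^esub> x) = a \<odot>\<^bsub>M'\<^esub> \<phi> x"
    and surj: "\<phi> ` carrier M = carrier M'"
    and pre: "\<And>x. x \<in> carrier M \<Longrightarrow> \<phi> x \<in> N' \<longleftrightarrow> x \<in> N"
  shows "modules_isomorphic R (quotient_module M N) (quotient_module M' N')"
proof -
  interpret M: module R M by fact
  interpret M': module R M' by fact
  interpret N: abelian_subgroup N M by (rule M.submodule_imp_abelian_subgroup [OF N])
  interpret N': abelian_subgroup N' M' by (rule M'.submodule_imp_abelian_subgroup [OF N'])
  have "\<phi> \<in> hom (add_monoid M) (add_monoid M')"
    by (rule homI) (use add surj in auto)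
  then interpret \<phi>: abelian_group_hom M M' \<phi>
    by (intro abelian_group_homI M.abelian_group_axioms M'.abelian_group_axioms group_hom.intro
        M.a_group M'.a_group group_hom_axioms.intro)
  have image_N: "\<phi> ` N = N'"
  proof
    show "\<phi> ` N \<subseteq> N'" using pre N.a_subset by blast
    show "N' \<subseteq> \<phi> ` N"
    proof
      fix y assume y: "y \<in> N'"
      then have "y \<in> \<phi> ` carrier M" using N'.a_subset surj by blast
      then show "y \<in> \<phi> ` N" using pre y by blast
    qed
  qed
  have image_coset: "\<phi> ` (N +>\<^bsub>M\<^esub> x) = N' +>\<^bsub>M'\<^esub> \<phi> x" if "x \<in> carrier M" for x
    unfolding a_r_coset_def' image_N [symmetric] using that by (auto simp: add image_iff)
  have cosets: "carrier (quotient_module M N) = (\<lambda>x. N +>\<^bsub>M\<^esub> x) ` carrier M"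
    "carrier (quotient_module M' N') = (\<lambda>x. N' +>\<^bsub>M'\<^esub> x) ` carrier M'"
    by (auto simp: quotient_module_def A_RCOSETS_def')
  have inj: "N +>\<^bsub>M\<^esub> x = N +>\<^bsub>M\<^esub> y" if "x \<in> carrier M" "y \<in> carrier M"
    "N' +>\<^bsub>M'\<^esub> \<phi> x = N' +>\<^bsub>M'\<^esub> \<phi> y" for x y
  proof -
    have "\<phi> x \<in> N' +>\<^bsub>M'\<^esub> \<phi> y"
      using that N'.a_rcos_self by (metis \<phi>.hom_closed)
    then have "\<phi> x \<oplus>\<^bsub>M'\<^esub> \<ominus>\<^bsub>M'\<^esub> \<phi> y \<in> N'"
      using that by (simp add: N'.a_rcos_module)
    then have "\<phi> (x \<oplus>\<^bsub>M\<^esub> \<ominus>\<^bsub>M\<^esub> y) \<in> N'"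
      using that by simp
    then have "x \<in> N +>\<^bsub>M\<^esub> y"
      using that pre [of "x \<oplus>\<^bsub>M\<^esub> \<ominus>\<^bsub>M\<^esub> y"] by (simp add: N.a_rcos_module)
    then show ?thesis
      using that N.a_repr_independence' by blast
  qed
  have "bij_betw (image \<phi>) (carrier (quotient_module M N)) (carrier (quotient_module M' N'))"
    unfolding bij_betw_def
  proof
    show "inj_on (image \<phi>) (carrier (quotient_module M N))"
      unfolding cosets
    proof (rule inj_onI, clarify)
      fix x y assume "x \<in> carrier M" "y \<in> carrier M" "\<phi> ` (N +>\<^bsub>M\<^esub> x) = \<phi> ` (N +>\<^bsub>M\<^esub> y)"
      then show "N +>\<^bsub>M\<^esub> x = N +>\<^bsub>M\<^esub> y"
        by (intro inj) (simp_all add: image_coset)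
    qed
    show "image \<phi> ` carrier (quotient_module M N) = carrier (quotient_module M' N')"
      unfolding cosets surj [symmetric] image_image by (rule image_cong) (auto simp: image_coset)
  qed
  moreover have "\<phi> ` (X \<oplus>\<^bsub>quotient_module M N\<^esub> Y) = \<phi> ` X \<oplus>\<^bsub>quotient_module M' N'\<^esub> \<phi> ` Y"
    if "X \<in> carrier (quotient_module M N)" "Y \<in> carrier (quotient_module M N)" for X Y
    using that unfolding cosets
    by (elim imageE) (simp add: quotient_module_def N.a_rcos_sum N'.a_rcos_sum image_coset add)
  moreover have "\<phi> ` (a \<odot>\<^bsub>quotient_module M N\<^esub> X) = a \<odot>\<^bsub>quotient_module M' N'\<^esub> \<phi> ` X"
    if "a \<in> carrier R" "X \<in> carrier (quotient_module M N)" for a X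
    using that unfolding cosets
    by (elim imageE) (simp add: M.quotient_module_smult [OF N] M'.quotient_module_smult [OF N'] image_coset smult)
  ultimately show ?thesis
    unfolding modules_isomorphic_def by blast
qed

lemma module_free_module:
  assumes "cring R"
  shows "module R (free_module R V)"
proof -
  interpret R: cring R by fact
  let ?F = "free_module R V"
  have carrier: "carrier ?F = V \<rightarrow>\<^sub>E carrier R"
    and ops: "\<zero>\<^bsub>?F\<^esub> = (\<lambda>v\<in>V. \<zero>\<^bsub>R\<^esub>)" "\<And>x y. x \<oplus>\<^bsub>?F\<^esub> y = (\<lambda>v\<in>V. x v \<oplus>\<^bsub>R\<^esub> y v)"
      "\<And>a x. a \<odot>\<^bsub>?F\<^esub> x = (\<lambda>v\<in>V. a \<otimes>\<^bsub>R\<^esub> x v)"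
    by (simp_all add: free_module_def)
  have mem: "x v \<in> carrier R" if "x \<in> carrier ?F" "v \<in> V" for x v
    using that by (auto simp: carrier)
  have eqI: "x = y" if "x \<in> carrier ?F" "y \<in> carrier ?F" "\<And>v. v \<in> V \<Longrightarrow> x v = y v" for x y
    using that unfolding carrier by (rule PiE_ext)
  have zero_closed: "\<zero>\<^bsub>?F\<^esub> \<in> carrier ?F"
    by (simp add: ops carrier)
  have add_closed: "x \<oplus>\<^bsub>?F\<^esub> y \<in> carrier ?F" if "x \<in> carrier ?F" "y \<in> carrier ?F" for x y
    using that mem by (simp add: ops carrier)
  have smult_closed: "a \<odot>\<^bsub>?F\<^esub> x \<in> carrier ?F" if "a \<in> carrier R" "x \<in> carrier ?F" for a x
    using that mem by (simp add: ops carrier)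
  show ?thesis
  proof (rule moduleI)
    show "cring R" by fact
    show "abelian_group ?F"
    proof (rule abelian_groupI)
      show "\<zero>\<^bsub>?F\<^esub> \<in> carrier ?F"
        by (rule zero_closed)
    next
      show "x \<oplus>\<^bsub>?F\<^esub> y \<in> carrier ?F" if "x \<in> carrier ?F" "y \<in> carrier ?F" for x y
        using that by (rule add_closed)
      show "x \<oplus>\<^bsub>?F\<^esub> y \<oplus>\<^bsub>?F\<^esub> z = x \<oplus>\<^bsub>?F\<^esub> (y \<oplus>\<^bsub>?F\<^esub> z)"
        if "x \<in> carrier ?F" "y \<in> carrier ?F" "z \<in> carrier ?F" for x y z
        unfolding ops by (rule restrict_ext) (simp add: that mem R.a_assoc)
      show "x \<oplus>\<^bsub>?F\<^esub> y = y \<oplus>\<^bsub>?F\<^esub> x" if "x \<in> carrier ?F" "y \<in> carrier ?F" for x y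
        unfolding ops by (rule restrict_ext) (simp add: that mem R.a_comm)
    next
      fix x assume x: "x \<in> carrier ?F"
      show "\<zero>\<^bsub>?F\<^esub> \<oplus>\<^bsub>?F\<^esub> x = x"
      proof (rule eqI)
        show "(\<zero>\<^bsub>?F\<^esub> \<oplus>\<^bsub>?F\<^esub> x) v = x v" if "v \<in> V" for v
          using x that by (simp add: ops mem)
      qed (use x zero_closed add_closed in blast)+
      show "\<exists>y\<in>carrier ?F. y \<oplus>\<^bsub>?F\<^esub> x = \<zero>\<^bsub>?F\<^esub>"
      proof (rule bexI [of _ "\<lambda>v\<in>V. \<ominus>\<^bsub>R\<^esub> x v"])
        show "(\<lambda>v\<in>V. \<ominus>\<^bsub>R\<^esub> x v) \<oplus>\<^bsub>?F\<^esub> x = \<zero>\<^bsub>?F\<^esub>"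
          unfolding ops by (rule restrict_ext) (simp add: x mem R.l_neg)
      qed (use x mem in \<open>simp add: carrier\<close>)
    qed
    show "a \<odot>\<^bsub>?F\<^esub> x \<in> carrier ?F" if "a \<in> carrier R" "x \<in> carrier ?F" for a x
      using that by (rule smult_closed)
    show "(a \<oplus>\<^bsub>R\<^esub> b) \<odot>\<^bsub>?F\<^esub> x = a \<odot>\<^bsub>?F\<^esub> x \<oplus>\<^bsub>?F\<^esub> b \<odot>\<^bsub>?F\<^esub> x"
      if "a \<in> carrier R" "b \<in> carrier R" "x \<in> carrier ?F" for a b x
      unfolding ops by (rule restrict_ext) (simp add: that mem R.l_distr)
    show "a \<odot>\<^bsub>?F\<^esub> (x \<oplus>\<^bsub>?F\<^esub> y) = a \<odot>\<^bsub>?F\<^esub> x \<oplus>\<^bsub>?F\<^esub> a \<odot>\<^bsub>?F\<^esub> y"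
      if "a \<in> carrier R" "x \<in> carrier ?F" "y \<in> carrier ?F" for a x y
      unfolding ops by (rule restrict_ext) (simp add: that mem R.r_distr)
    show "(a \<otimes>\<^bsub>R\<^esub> b) \<odot>\<^bsub>?F\<^esub> x = a \<odot>\<^bsub>?F\<^esub> (b \<odot>\<^bsub>?F\<^esub> x)"
      if "a \<in> carrier R" "b \<in> carrier R" "x \<in> carrier ?F" for a b x
      unfolding ops by (rule restrict_ext) (simp add: that mem R.m_assoc)
    show "\<one>\<^bsub>R\<^esub> \<odot>\<^bsub>?F\<^esub> x = x" if x: "x \<in> carrier ?F" for x
    proof (rule eqI)
      show "(\<one>\<^bsub>R\<^esub> \<odot>\<^bsub>?F\<^esub> x) v = x v" if "v \<in> V" for v
        using x that by (simp add: ops mem)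
    qed (use x smult_closed R.one_closed in blast)+
  qed
qed

section \<open>Cokernels of Laurent polynomial matrices\<close>

lemma laurent_zero: "0 \<in> carrier (laurent_ring g)"
  and laurent_one: "1 \<in> carrier (laurent_ring g)"
  by (auto simp: laurent_ring_def)

lemma laurent_add:
  "p \<in> carrier (laurent_ring g) \<Longrightarrow> q \<in> carrier (laurent_ring g) \<Longrightarrow> p + q \<in> carrier (laurent_ring g)"
  using Poly_Mapping.keys_add [of p q] by (auto simp: laurent_ring_def)

lemma laurent_uminus: "p \<in> carrier (laurent_ring g) \<Longrightarrow> - p \<in> carrier (laurent_ring g)"
  by (auto simp: laurent_ring_def)

lemma laurent_diff:
  "p \<in> carrier (laurent_ring g) \<Longrightarrow> q \<in> carrier (laurent_ring g) \<Longrightarrow> p - q \<in> carrier (laurent_ring g)"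
  using laurent_add [of p g "- q"] laurent_uminus by simp

lemma laurent_mult:
  assumes "p \<in> carrier (laurent_ring g)" "q \<in> carrier (laurent_ring g)"
  shows "p * q \<in> carrier (laurent_ring g)"
proof -
  have "Poly_Mapping.keys m \<subseteq> vars g" if m: "m \<in> Poly_Mapping.keys (p * q)" for m
  proof -
    obtain a b where "m = a + b" "a \<in> Poly_Mapping.keys p" "b \<in> Poly_Mapping.keys q"
      using m Poly_Mapping.keys_mult [of p q] by blast
    moreover have "Poly_Mapping.keys a \<subseteq> vars g" "Poly_Mapping.keys b \<subseteq> vars g"
      using assms calculation by (simp_all add: laurent_ring_def)
    ultimately show ?thesis
      using Poly_Mapping.keys_add [of a b] by blast
  qed
  then show ?thesis by (simp add: laurent_ring_def)
qed

lemma laurent_sum: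
  "(\<And>i. i \<in> I \<Longrightarrow> f i \<in> carrier (laurent_ring g)) \<Longrightarrow> sum f I \<in> carrier (laurent_ring g)"
  by (induction I rule: infinite_finite_induct) (auto simp: laurent_zero laurent_add)

lemma laurent_of_int: "of_int k \<in> carrier (laurent_ring g)"
proof -
  have "of_nat n \<in> carrier (laurent_ring g)" for n
    by (induction n) (auto simp: laurent_zero laurent_one laurent_add)
  then show ?thesis
    by (cases k rule: int_cases2) (auto simp: laurent_uminus)
qed

lemmas laurent_closed = laurent_zero laurent_one laurent_add laurent_uminus laurent_diff laurent_mult
  laurent_sum laurent_of_int

lemma laurent_ring_ops:
  "\<zero>\<^bsub>laurent_ring g\<^esub> = 0" "\<one>\<^bsub>laurent_ring g\<^esub> = 1"
  "p \<oplus>\<^bsub>laurent_ring g\<^esub> q = p + q" "p \<otimes>\<^bsub>laurent_ring g\<^esub> q = p * q"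
  by (simp_all add: laurent_ring_def)

lemma cring_laurent_ring: "cring (laurent_ring g)"
proof (rule cringI)
  show "abelian_group (laurent_ring g)"
  proof (rule abelian_groupI)
    fix x assume "x \<in> carrier (laurent_ring g)"
    then show "\<exists>y\<in>carrier (laurent_ring g). y \<oplus>\<^bsub>laurent_ring g\<^esub> x = \<zero>\<^bsub>laurent_ring g\<^esub>"
      by (intro bexI [of _ "- x"]) (simp_all add: laurent_ring_ops laurent_uminus)
  qed (simp_all add: laurent_ring_ops laurent_zero laurent_add add_ac)
  show "comm_monoid (laurent_ring g)"
    by (rule comm_monoidI) (simp_all add: laurent_ring_ops laurent_one laurent_mult mult_ac)
qed (simp add: laurent_ring_ops distrib_right)

text \<open>The submodule generated by the rows of the matrix \<open>L\<close>, as the set of their linear combinations.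
  Rows and columns have separate index sets, since a pivot may delete a row and a column with
  different labels.\<close>

definition row_span :: "nat \<Rightarrow> 'i set \<Rightarrow> 'j set \<Rightarrow> ('i \<Rightarrow> 'j \<Rightarrow> laurent) \<Rightarrow> ('j \<Rightarrow> laurent) set" where
  "row_span g I J L = (\<lambda>x. \<lambda>j\<in>J. \<Sum>i\<in>I. x i * L i j) ` (I \<rightarrow>\<^sub>E carrier (laurent_ring g))"

definition cokernel_module ::
    "nat \<Rightarrow> 'i set \<Rightarrow> 'j set \<Rightarrow> ('i \<Rightarrow> 'j \<Rightarrow> laurent) \<Rightarrow> (laurent, ('j \<Rightarrow> laurent) set) module" where
  "cokernel_module g I J L = quotient_module (free_module (laurent_ring g) J) (row_span g I J L)"

abbreviation matrix_over :: "nat \<Rightarrow> 'i set \<Rightarrow> 'j set \<Rightarrow> ('i \<Rightarrow> 'j \<Rightarrow> laurent) \<Rightarrow> bool" where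
  "matrix_over g I J L \<equiv> \<forall>i\<in>I. \<forall>j\<in>J. L i j \<in> carrier (laurent_ring g)"

text \<open>The coefficients may be taken as total functions, which removes the extensionality conditions from
  the linear combinations.\<close>

lemma mem_row_span:
  "y \<in> row_span g I J L \<longleftrightarrow> y \<in> extensional J \<and>
     (\<exists>x. (\<forall>i\<in>I. x i \<in> carrier (laurent_ring g)) \<and> (\<forall>j\<in>J. y j = (\<Sum>i\<in>I. x i * L i j)))"
proof
  assume "y \<in> row_span g I J L"
  then show "y \<in> extensional J \<and>
     (\<exists>x. (\<forall>i\<in>I. x i \<in> carrier (laurent_ring g)) \<and> (\<forall>j\<in>J. y j = (\<Sum>i\<in>I. x i * L i j)))"
    by (auto simp: row_span_def)
next
  assume "y \<in> extensional J \<and>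
     (\<exists>x. (\<forall>i\<in>I. x i \<in> carrier (laurent_ring g)) \<and> (\<forall>j\<in>J. y j = (\<Sum>i\<in>I. x i * L i j)))"
  then obtain x where x: "y \<in> extensional J" "\<forall>i\<in>I. x i \<in> carrier (laurent_ring g)"
    "\<forall>j\<in>J. y j = (\<Sum>i\<in>I. x i * L i j)" by blast
  then have "y = (\<lambda>j\<in>J. \<Sum>i\<in>I. restrict x I i * L i j)"
    by (intro extensionalityI [of _ J]) auto
  then show "y \<in> row_span g I J L"
    unfolding row_span_def using x(2) by (intro image_eqI [of _ _ "restrict x I"]) auto
qed

lemma mem_free_module_laurent:
  "y \<in> carrier (free_module (laurent_ring g) J) \<longleftrightarrow>
     y \<in> extensional J \<and> (\<forall>j\<in>J. y j \<in> carrier (laurent_ring g))"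
  by (auto simp: free_module_def PiE_iff)

lemma carrier_free_module: "carrier (free_module R J) = J \<rightarrow>\<^sub>E carrier R"
  by (simp add: free_module_def)

lemma free_module_laurent_ops:
  "x \<oplus>\<^bsub>free_module (laurent_ring g) J\<^esub> y = (\<lambda>j\<in>J. x j + y j)"
  "a \<odot>\<^bsub>free_module (laurent_ring g) J\<^esub> y = (\<lambda>j\<in>J. a * y j)"
  "\<zero>\<^bsub>free_module (laurent_ring g) J\<^esub> = (\<lambda>j\<in>J. 0)"
  by (simp_all add: free_module_def laurent_ring_ops)

lemma submodule_row_span:
  assumes "matrix_over g I J L"
  shows "submodule (row_span g I J L) (laurent_ring g) (free_module (laurent_ring g) J)"
proof (rule module.submoduleI_smult [OF module_free_module [OF cring_laurent_ring]])
  show "row_span g I J L \<subseteq> carrier (free_module (laurent_ring g) J)"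
    using assms by (auto simp: mem_row_span mem_free_module_laurent intro!: laurent_closed)
  show "\<zero>\<^bsub>free_module (laurent_ring g) J\<^esub> \<in> row_span g I J L"
    by (auto simp: mem_row_span free_module_laurent_ops laurent_zero intro!: exI [of _ "\<lambda>_. 0"])
  show "x \<oplus>\<^bsub>free_module (laurent_ring g) J\<^esub> y \<in> row_span g I J L"
    if xy: "x \<in> row_span g I J L" "y \<in> row_span g I J L" for x y
  proof -
    obtain a b where "\<forall>i\<in>I. a i \<in> carrier (laurent_ring g)" "\<forall>j\<in>J. x j = (\<Sum>i\<in>I. a i * L i j)"
      "\<forall>i\<in>I. b i \<in> carrier (laurent_ring g)" "\<forall>j\<in>J. y j = (\<Sum>i\<in>I. b i * L i j)"
      using xy by (auto simp: mem_row_span)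
    then show ?thesis
      by (auto simp: mem_row_span free_module_laurent_ops laurent_add sum.distrib distrib_right
          intro!: exI [of _ "\<lambda>i. a i + b i"])
  qed
  show "k \<odot>\<^bsub>free_module (laurent_ring g) J\<^esub> x \<in> row_span g I J L"
    if kx: "k \<in> carrier (laurent_ring g)" "x \<in> row_span g I J L" for k x
  proof -
    obtain a where "\<forall>i\<in>I. a i \<in> carrier (laurent_ring g)" "\<forall>j\<in>J. x j = (\<Sum>i\<in>I. a i * L i j)"
      using kx by (auto simp: mem_row_span)
    then show ?thesis
      using kx(1) by (auto simp: mem_row_span free_module_laurent_ops laurent_mult sum_distrib_left mult.assoc
          intro!: exI [of _ "\<lambda>i. k * a i"])
  qed
qed

lemma cokernel_modules_isomorphic:
  assumes "matrix_over g I J L" "matrix_over g I' J' L'"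
    and add: "\<And>x y. x \<in> extensional J \<Longrightarrow> y \<in> extensional J \<Longrightarrow> \<phi> (\<lambda>j\<in>J. x j + y j) = (\<lambda>j\<in>J'. \<phi> x j + \<phi> y j)"
    and smult: "\<And>a x. x \<in> extensional J \<Longrightarrow> \<phi> (\<lambda>j\<in>J. a * x j) = (\<lambda>j\<in>J'. a * \<phi> x j)"
    and surj: "\<phi> ` (J \<rightarrow>\<^sub>E carrier (laurent_ring g)) = (J' \<rightarrow>\<^sub>E carrier (laurent_ring g))"
    and pre: "\<And>x. x \<in> J \<rightarrow>\<^sub>E carrier (laurent_ring g) \<Longrightarrow> \<phi> x \<in> row_span g I' J' L' \<longleftrightarrow> x \<in> row_span g I J L"
  shows "modules_isomorphic (laurent_ring g) (cokernel_module g I J L) (cokernel_module g I' J' L')"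
  unfolding cokernel_module_def
proof (rule quotient_modules_isomorphic [where \<phi> = \<phi>])
  show "\<phi> (x \<oplus>\<^bsub>free_module (laurent_ring g) J\<^esub> y) = \<phi> x \<oplus>\<^bsub>free_module (laurent_ring g) J'\<^esub> \<phi> y"
    if "x \<in> carrier (free_module (laurent_ring g) J)" "y \<in> carrier (free_module (laurent_ring g) J)" for x y
    using that add by (simp add: free_module_laurent_ops mem_free_module_laurent)
  show "\<phi> (a \<odot>\<^bsub>free_module (laurent_ring g) J\<^esub> x) = a \<odot>\<^bsub>free_module (laurent_ring g) J'\<^esub> \<phi> x"
    if "x \<in> carrier (free_module (laurent_ring g) J)" for a x
    using that smult by (simp add: free_module_laurent_ops mem_free_module_laurent)
qed (use assms surj pre in \<open>auto simp: module_free_module cring_laurent_ring submodule_row_span carrier_free_module\<close>)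

lemma cokernel_module_cong:
  assumes "\<And>i j. i \<in> I \<Longrightarrow> j \<in> J \<Longrightarrow> L i j = L' i j"
  shows "cokernel_module g I J L = cokernel_module g I J L'"
proof -
  have "row_span g I J L = row_span g I J L'"
    using assms by (auto simp: mem_row_span set_eq_iff)
  then show ?thesis by (simp add: cokernel_module_def)
qed

lemma cokernel_modules_isomorphic_sym:
  assumes "modules_isomorphic (laurent_ring g) (cokernel_module g I J L) N" "matrix_over g I J L"
  shows "modules_isomorphic (laurent_ring g) N (cokernel_module g I J L)"
proof (rule modules_isomorphic_sym [OF assms(1)])
  note closed = module.quotient_module_closed [OF module_free_module [OF cring_laurent_ring] submodule_row_span [OF assms(2)]]
  show "x \<oplus>\<^bsub>cokernel_module g I J L\<^esub> y \<in> carrier (cokernel_module g I J L)"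
    if "x \<in> carrier (cokernel_module g I J L)" "y \<in> carrier (cokernel_module g I J L)" for x y
    using that unfolding cokernel_module_def by (rule closed(1))
  show "a \<odot>\<^bsub>cokernel_module g I J L\<^esub> x \<in> carrier (cokernel_module g I J L)"
    if "a \<in> carrier (laurent_ring g)" "x \<in> carrier (cokernel_module g I J L)" for a x
    using that unfolding cokernel_module_def by (rule closed(2))
qed

text \<open>The quotient map eliminates the generator \<open>c\<close> by means of the relation \<open>r\<close>, which in the cokernel
  reads \<open>c = -u \<Sum>\<^sub>j L r j \<cdot> j\<close> with \<open>j\<close> running over the other generators.  So a row vector \<open>y\<close> is
  sent to \<open>y\<close> minus \<open>y\<^sub>c u\<close> times the row \<open>r\<close>.  This sends the row \<open>r\<close> to zero and the other rows to the
  rows of the Schur complement; conversely, if the image of \<open>y\<close> is a combination of those rows, then \<open>y\<close> is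
  the same combination of the original rows plus the multiple of the row \<open>r\<close> that corrects the
  entry at \<open>c\<close>.\<close>

lemma cokernel_module_pivot:
  assumes fin: "finite I" and L: "matrix_over g I J L" and r: "r \<in> I" and c: "c \<in> J"
    and u: "u \<in> carrier (laurent_ring g)" "L r c * u = 1"
    and L': "\<And>i j. i \<in> I - {r} \<Longrightarrow> j \<in> J - {c} \<Longrightarrow> L' i j = L i j - L i c * u * L r j"
  shows "modules_isomorphic (laurent_ring g) (cokernel_module g I J L)
           (cokernel_module g (I - {r}) (J - {c}) L')"
proof -
  let ?K = "carrier (laurent_ring g)"
  define \<phi> :: "('b \<Rightarrow> laurent) \<Rightarrow> 'b \<Rightarrow> laurent" where
    "\<phi> y = (\<lambda>j\<in>J - {c}. y j - y c * u * L r j)" for y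
  have split: "(\<Sum>i\<in>I. f i) = f r + (\<Sum>i\<in>I - {r}. f i)" for f :: "'a \<Rightarrow> laurent"
    using fin r by (rule sum.remove)
  have sum_L': "(\<Sum>i\<in>I - {r}. x i * L' i j) =
      (\<Sum>i\<in>I - {r}. x i * L i j) - (\<Sum>i\<in>I - {r}. x i * L i c) * u * L r j" if "j \<in> J - {c}" for x j
    unfolding sum_distrib_right sum_subtractf [symmetric]
    by (rule sum.cong) (use that in \<open>auto simp: L' algebra_simps\<close>)
  have \<phi>_combination: "y j - y c * u * L r j = (\<Sum>i\<in>I - {r}. x i * L' i j)"
    if y: "\<forall>j\<in>J. y j = (\<Sum>i\<in>I. x i * L i j)" and j: "j \<in> J - {c}" for x y j
  proof -
    have "y j - y c * u * L r j =
        x r * L r j + (\<Sum>i\<in>I - {r}. x i * L i j) - (x r * L r c + (\<Sum>i\<in>I - {r}. x i * L i c)) * u * L r j"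
      using y j c by (simp add: split)
    also have "\<dots> = x r * L r j * (1 - L r c * u) + ((\<Sum>i\<in>I - {r}. x i * L i j) - (\<Sum>i\<in>I - {r}. x i * L i c) * u * L r j)"
      by (simp add: algebra_simps)
    also have "\<dots> = (\<Sum>i\<in>I - {r}. x i * L i j) - (\<Sum>i\<in>I - {r}. x i * L i c) * u * L r j"
      using u(2) by simp
    also have "\<dots> = (\<Sum>i\<in>I - {r}. x i * L' i j)"
      using sum_L' [OF j] by simp
    finally show ?thesis .
  qed
  show ?thesis
  proof (rule cokernel_modules_isomorphic [where \<phi> = \<phi>, OF L])
    show "matrix_over g (I - {r}) (J - {c}) L'"
      using L u r c by (auto simp: L' intro!: laurent_closed)
    show "\<phi> (\<lambda>j\<in>J. x j + y j) = (\<lambda>j\<in>J - {c}. \<phi> x j + \<phi> y j)" for x y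
      unfolding \<phi>_def by (rule restrict_ext) (use c in \<open>simp add: algebra_simps\<close>)
    show "\<phi> (\<lambda>j\<in>J. a * x j) = (\<lambda>j\<in>J - {c}. a * \<phi> x j)" for a x
      unfolding \<phi>_def by (rule restrict_ext) (use c in \<open>simp add: algebra_simps\<close>)
    show "\<phi> ` (J \<rightarrow>\<^sub>E ?K) = (J - {c} \<rightarrow>\<^sub>E ?K)"
    proof
      show "\<phi> ` (J \<rightarrow>\<^sub>E ?K) \<subseteq> (J - {c} \<rightarrow>\<^sub>E ?K)"
        unfolding \<phi>_def image_subset_iff restrict_PiE_iff
        using L u r c by (auto simp: PiE_iff intro!: laurent_closed)
      show "(J - {c} \<rightarrow>\<^sub>E ?K) \<subseteq> \<phi> ` (J \<rightarrow>\<^sub>E ?K)"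
      proof
        fix y assume y: "y \<in> J - {c} \<rightarrow>\<^sub>E ?K"
        let ?z = "\<lambda>j\<in>J. if j = c then 0 else y j"
        have "?z \<in> J \<rightarrow>\<^sub>E ?K"
          using y laurent_zero by (auto simp: PiE_iff)
        moreover have "y = \<phi> ?z"
        proof (rule extensionalityI [of _ "J - {c}"])
          show "y j = \<phi> ?z j" if "j \<in> J - {c}" for j
            using that c by (simp add: \<phi>_def)
        qed (use y in \<open>auto simp: \<phi>_def PiE_iff\<close>)
        ultimately show "y \<in> \<phi> ` (J \<rightarrow>\<^sub>E ?K)" by blast
      qed
    qed
    fix y assume y: "y \<in> J \<rightarrow>\<^sub>E ?K"
    show "\<phi> y \<in> row_span g (I - {r}) (J - {c}) L' \<longleftrightarrow> y \<in> row_span g I J L"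
    proof
      assume "y \<in> row_span g I J L"
      then obtain x where "\<forall>i\<in>I. x i \<in> ?K" "\<forall>j\<in>J. y j = (\<Sum>i\<in>I. x i * L i j)"
        by (auto simp: mem_row_span)
      then show "\<phi> y \<in> row_span g (I - {r}) (J - {c}) L'"
        using \<phi>_combination [of y x] unfolding mem_row_span by (intro conjI exI [of _ x]) (auto simp: \<phi>_def)
    next
      assume "\<phi> y \<in> row_span g (I - {r}) (J - {c}) L'"
      then obtain x where x: "\<forall>i\<in>I - {r}. x i \<in> ?K"
        and y_x: "\<forall>j\<in>J - {c}. y j - y c * u * L r j = (\<Sum>i\<in>I - {r}. x i * L' i j)"
        unfolding mem_row_span by (force simp: \<phi>_def)
      \<comment> \<open>the coefficient of the row \<open>r\<close> is forced by the entry at \<open>c\<close>\<close>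
      define x' where "x' = x(r := u * (y c - (\<Sum>i\<in>I - {r}. x i * L i c)))"
      have sum_x': "(\<Sum>i\<in>I. x' i * L i j) =
          u * (y c - (\<Sum>i\<in>I - {r}. x i * L i c)) * L r j + (\<Sum>i\<in>I - {r}. x i * L i j)" for j
        unfolding split by (simp add: x'_def)
      have "y j = (\<Sum>i\<in>I. x' i * L i j)" if j: "j \<in> J" for j
      proof (cases "j = c")
        case True
        have "u * d * L r c = d" for d
          using u(2) by (metis mult.assoc mult.commute mult.right_neutral)
        then show ?thesis by (simp add: sum_x' True)
      next
        case False
        then have "y j = y c * u * L r j + (\<Sum>i\<in>I - {r}. x i * L' i j)"
          using bspec [OF y_x, of j] j by (simp add: diff_eq_eq add.commute)
        also have "(\<Sum>i\<in>I - {r}. x i * L' i j) = (\<Sum>i\<in>I - {r}. x i * L i j) - (\<Sum>i\<in>I - {r}. x i * L i c) * u * L r j"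
          using sum_L' j False by simp
        finally show ?thesis
          unfolding sum_x' by (simp add: algebra_simps)
      qed
      moreover have "\<forall>i\<in>I. x' i \<in> ?K"
        using x y u L r c by (auto simp: x'_def PiE_iff intro!: laurent_closed)
      moreover have "y \<in> extensional J" using y by (simp add: PiE_iff)
      ultimately show "y \<in> row_span g I J L"
        by (auto simp: mem_row_span)
    qed
  qed
qed

lemma cokernel_module_rescale:
  assumes m: "bij_betw m I I'" and n: "bij_betw n J J'" and L: "matrix_over g I J L"
    and \<sigma>: "\<And>i. i \<in> I \<Longrightarrow> \<sigma> i \<in> carrier (laurent_ring g) \<and> \<sigma>' i \<in> carrier (laurent_ring g) \<and> \<sigma> i * \<sigma>' i = 1"
    and \<tau>: "\<And>j. j \<in> J \<Longrightarrow> \<tau> j \<in> carrier (laurent_ring g) \<and> \<tau>' j \<in> carrier (laurent_ring g) \<and> \<tau> j * \<tau>' j = 1"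
    and L': "\<And>i j. i \<in> I \<Longrightarrow> j \<in> J \<Longrightarrow> L' (m i) (n j) = \<sigma> i * L i j * \<tau> j"
  shows "modules_isomorphic (laurent_ring g) (cokernel_module g I J L) (cokernel_module g I' J' L')"
proof -
  let ?K = "carrier (laurent_ring g)"
  define k where "k = the_inv_into J n"
  define h where "h = the_inv_into I m"
  have k: "k (n j) = j" "n j \<in> J'" if "j \<in> J" for j
    using n that by (auto simp: k_def bij_betw_def the_inv_into_f_f)
  have k': "k j \<in> J" "n (k j) = j" if "j \<in> J'" for j
    using n that by (auto simp: k_def bij_betw_def the_inv_into_into f_the_inv_into_f)
  have h: "h (m i) = i" "m i \<in> I'" if "i \<in> I" for i
    using m that by (auto simp: h_def bij_betw_def the_inv_into_f_f)
  have h': "h i \<in> I" "m (h i) = i" if "i \<in> I'" for i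
    using m that by (auto simp: h_def bij_betw_def the_inv_into_into f_the_inv_into_f)
  define \<phi> :: "('c \<Rightarrow> laurent) \<Rightarrow> 'd \<Rightarrow> laurent" where
    "\<phi> y = (\<lambda>j\<in>J'. y (k j) * \<tau> (k j))" for y
  have sum_L': "(\<Sum>i\<in>I'. x i * L' i (n j)) = (\<Sum>i\<in>I. x (m i) * \<sigma> i * L i j) * \<tau> j" if "j \<in> J" for x j
    unfolding sum.reindex_bij_betw [OF m, symmetric] sum_distrib_right
    by (rule sum.cong) (use that in \<open>auto simp: L' mult.assoc\<close>)
  show ?thesis
  proof (rule cokernel_modules_isomorphic [where \<phi> = \<phi>, OF L])
    show "matrix_over g I' J' L'"
    proof (intro ballI)
      fix i j assume "i \<in> I'" "j \<in> J'"
      then show "L' i j \<in> ?K"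
        using L' [of "h i" "k j"] h' k' L \<sigma> \<tau> by (simp add: laurent_mult)
    qed
    show "\<phi> (\<lambda>j\<in>J. x j + y j) = (\<lambda>j\<in>J'. \<phi> x j + \<phi> y j)" for x y
      unfolding \<phi>_def by (rule restrict_ext) (use k' in \<open>simp add: algebra_simps\<close>)
    show "\<phi> (\<lambda>j\<in>J. a * x j) = (\<lambda>j\<in>J'. a * \<phi> x j)" for a x
      unfolding \<phi>_def by (rule restrict_ext) (use k' in \<open>simp add: algebra_simps\<close>)
    show "\<phi> ` (J \<rightarrow>\<^sub>E ?K) = (J' \<rightarrow>\<^sub>E ?K)"
    proof
      show "\<phi> ` (J \<rightarrow>\<^sub>E ?K) \<subseteq> (J' \<rightarrow>\<^sub>E ?K)"
        unfolding \<phi>_def image_subset_iff restrict_PiE_iff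
        using k' \<tau> by (auto simp: PiE_iff intro!: laurent_mult)
      show "(J' \<rightarrow>\<^sub>E ?K) \<subseteq> \<phi> ` (J \<rightarrow>\<^sub>E ?K)"
      proof
        fix y assume y: "y \<in> J' \<rightarrow>\<^sub>E ?K"
        let ?z = "\<lambda>j\<in>J. y (n j) * \<tau>' j"
        have "?z \<in> J \<rightarrow>\<^sub>E ?K"
          using y k \<tau> by (auto simp: PiE_iff intro!: laurent_mult)
        moreover have "\<phi> ?z j = y j" if "j \<in> J'" for j
        proof -
          have "y j * \<tau>' (k j) * \<tau> (k j) = y j"
            using \<tau> [of "k j"] k' that by (metis mult.assoc mult.commute mult.right_neutral)
          then show ?thesis using k' that by (simp add: \<phi>_def)
        qed
        then have "y = \<phi> ?z"
          using y by (intro extensionalityI [of _ J']) (auto simp: \<phi>_def PiE_iff)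
        ultimately show "y \<in> \<phi> ` (J \<rightarrow>\<^sub>E ?K)" by blast
      qed
    qed
    fix y assume y: "y \<in> J \<rightarrow>\<^sub>E ?K"
    show "\<phi> y \<in> row_span g I' J' L' \<longleftrightarrow> y \<in> row_span g I J L"
    proof
      assume "y \<in> row_span g I J L"
      then obtain x where x: "\<forall>i\<in>I. x i \<in> ?K" "\<forall>j\<in>J. y j = (\<Sum>i\<in>I. x i * L i j)"
        by (auto simp: mem_row_span)
      let ?x' = "\<lambda>i. x (h i) * \<sigma>' (h i)"
      have "\<phi> y j = (\<Sum>i\<in>I'. ?x' i * L' i j)" if "j \<in> J'" for j
      proof -
        have "?x' (m i) * \<sigma> i = x i" if "i \<in> I" for i
          using \<sigma> [OF that] h(1) [OF that] by (metis mult.assoc mult.commute mult.right_neutral)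
        then have "(\<Sum>i\<in>I'. ?x' i * L' i (n (k j))) = (\<Sum>i\<in>I. x i * L i (k j)) * \<tau> (k j)"
          using k' that by (subst sum_L') auto
        then show ?thesis
          using x(2) k' that by (simp add: \<phi>_def)
      qed
      moreover have "\<forall>i\<in>I'. ?x' i \<in> ?K"
        using x(1) \<sigma> h' by (simp add: laurent_mult)
      ultimately show "\<phi> y \<in> row_span g I' J' L'"
        by (auto simp: mem_row_span \<phi>_def intro!: exI [of _ ?x'])
    next
      assume "\<phi> y \<in> row_span g I' J' L'"
      then obtain x where x: "\<forall>i\<in>I'. x i \<in> ?K" "\<forall>j\<in>J'. \<phi> y j = (\<Sum>i\<in>I'. x i * L' i j)"
        by (auto simp: mem_row_span)
      have "y j = (\<Sum>i\<in>I. x (m i) * \<sigma> i * L i j)" if "j \<in> J" for j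
      proof -
        have "y j * \<tau> j = (\<Sum>i\<in>I. x (m i) * \<sigma> i * L i j) * \<tau> j"
          using x(2) k [OF that] sum_L' [OF that] by (force simp: \<phi>_def)
        then have "y j * \<tau> j * \<tau>' j = (\<Sum>i\<in>I. x (m i) * \<sigma> i * L i j) * \<tau> j * \<tau>' j"
          by simp
        then show ?thesis using \<tau> [OF that] by (simp add: mult.assoc)
      qed
      moreover have "\<forall>i\<in>I. x (m i) * \<sigma> i \<in> ?K"
        using x(1) h \<sigma> by (simp add: laurent_mult)
      ultimately show "y \<in> row_span g I J L"
        using y by (auto simp: mem_row_span PiE_iff intro!: exI [of _ "\<lambda>i. x (m i) * \<sigma> i"])
    qed
  qed
qed

section \<open>The Laplacian as a sum of edge matrices\<close>

lemma admissible_path_reversepath: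
  "admissible_path S A g c p \<Longrightarrow> admissible_path S A g c (reversepath p)"
  by (simp add: admissible_path_def transverse_reversepath)

lemma admissible_path_joinpaths:
  "admissible_path S A g c p \<Longrightarrow> admissible_path S A g c q \<Longrightarrow> pathfinish p = pathstart q \<Longrightarrow>
     admissible_path S A g c (p +++ q)"
  by (simp add: admissible_path_def transverse_joinpaths subset_path_image_join)

lemma path_monomial_reversepath: "path_monomial A g c (reversepath p) = - path_monomial A g c p"
  by (simp add: path_monomial_def crossing_number_reversepath single_uminus sum_negf [symmetric])

lemma XV_YV_in_vars: "k < g \<Longrightarrow> XV k \<in> vars g" "k < g \<Longrightarrow> YV k \<in> vars g"
  by (auto simp: vars_def)

lemma path_monomial_joinpaths:
  assumes "admissible_path S A g c p" "admissible_path S A g c q" "pathfinish p = pathstart q"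
  shows "path_monomial A g c (p +++ q) = path_monomial A g c p + path_monomial A g c q"
  unfolding path_monomial_def sum.distrib [symmetric]
  by (rule sum.cong) (use assms in \<open>auto simp: crossing_number_joinpaths admissible_path_def
      XV_YV_in_vars single_add single_uminus single_diff algebra_simps\<close>)

text \<open>The intersection form needed for homotopy invariance comes with the symplectic basis.\<close>

lemma path_monomial_homotopic_paths:
  assumes c: "symplectic_basis S A g c" and pq: "homotopic_paths S p q"
    and adm: "admissible_path S A g c p" "admissible_path S A g c q"
  shows "path_monomial A g c p = path_monomial A g c q"
proof -
  obtain \<omega> where \<omega>: "intersection_form S A \<omega>"
    using c by (auto simp: symplectic_basis_def)
  have "crossing_number A p (c v) = crossing_number A q (c v)" if "v \<in> vars g" for v
    using c pq adm that
    by (intro crossing_number_homotopic_paths [OF \<omega>]) (auto simp: symplectic_basis_def admissible_path_def)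
  then show ?thesis
    unfolding path_monomial_def by (intro sum.cong) (simp_all add: XV_YV_in_vars)
qed

lemma path_monomial_const:
  assumes "\<forall>v\<in>vars g. a \<notin> range (c v)"
  shows "path_monomial A g c (\<lambda>_. a) = 0"
proof -
  have "crossing_number A (\<lambda>_. a) (c v) = 0" if "v \<in> vars g" for v
  proof -
    have "crossings A \<epsilon> (\<lambda>_. a) (c v) = {}" for \<epsilon>
    proof -
      have "a \<noteq> c v s" for s using assms that by blast
      then show ?thesis
        using crossings_subset_meetings [of A \<epsilon> "\<lambda>_. a" "c v"] by (auto simp: meetings_def)
    qed
    then show ?thesis by (simp add: crossing_number_def)
  qed
  then show ?thesis
    by (simp add: path_monomial_def XV_YV_in_vars)
qed

lemma keys_path_monomial: "Poly_Mapping.keys (path_monomial A g c p) \<subseteq> vars g"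
proof -
  let ?f = "\<lambda>k. Poly_Mapping.single (XV k) (crossing_number A p (c (YV k))) +
             Poly_Mapping.single (YV k) (- crossing_number A p (c (XV k)))"
  have "Poly_Mapping.keys (?f k) \<subseteq> vars g" if "k < g" for k
    using Poly_Mapping.keys_add [of "Poly_Mapping.single (XV k) (crossing_number A p (c (YV k)))"
        "Poly_Mapping.single (YV k) (- crossing_number A p (c (XV k)))"] XV_YV_in_vars [OF that]
    by (auto split: if_splits)
  then show ?thesis
    unfolding path_monomial_def using Poly_Mapping.keys_sum [of ?f "{..<g}"] by blast
qed

abbreviation mon :: "monomial \<Rightarrow> laurent" where
  "mon \<mu> \<equiv> Poly_Mapping.single \<mu> 1"

lemma mono_mult: "mon \<mu> * mon \<nu> = mon (\<mu> + \<nu>)"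
  by (simp add: mult_single)

lemma mono_in_laurent_ring: "Poly_Mapping.keys \<mu> \<subseteq> vars g \<Longrightarrow> mon \<mu> \<in> carrier (laurent_ring g)"
  by (simp add: laurent_ring_def)

text \<open>The contribution to the Laplacian of an undirected edge of sign \<open>s\<close> whose direction from \<open>a\<close> to
  \<open>b\<close> has connection \<open>\<mu>\<close>.  Products of indicator functions cover loops (\<open>a = b\<close>) without a case
  distinction: the diagonal entry is then \<open>s (2 - \<mu> - \<mu>\<inverse>)\<close>, in multiplicative notation.\<close>

definition edge_matrix :: "'v \<Rightarrow> 'v \<Rightarrow> int \<Rightarrow> monomial \<Rightarrow> 'v \<Rightarrow> 'v \<Rightarrow> laurent" where
  "edge_matrix a b s \<mu> v w = of_int s *
     (of_bool (v = a) * of_bool (w = a) + of_bool (v = b) * of_bool (w = b)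
      - of_bool (v = a) * of_bool (w = b) * mon \<mu> - of_bool (v = b) * of_bool (w = a) * mon (- \<mu>))"

lemma edge_matrix_swap: "edge_matrix b a s (- \<mu>) = edge_matrix a b s \<mu>"
  by (simp add: edge_matrix_def fun_eq_iff algebra_simps)

lemma edge_matrix_outside:
  "v \<noteq> a \<Longrightarrow> v \<noteq> b \<Longrightarrow> edge_matrix a b s \<mu> v w = 0"
  "w \<noteq> a \<Longrightarrow> w \<noteq> b \<Longrightarrow> edge_matrix a b s \<mu> v w = 0"
  by (auto simp: edge_matrix_def)

lemma edge_matrix_in_laurent_ring:
  "Poly_Mapping.keys \<mu> \<subseteq> vars g \<Longrightarrow> edge_matrix a b s \<mu> v w \<in> carrier (laurent_ring g)"
  unfolding edge_matrix_def of_bool_def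
  by (intro laurent_mult laurent_diff laurent_add laurent_of_int mono_in_laurent_ring)
     (simp_all add: laurent_closed)

text \<open>Moving each vertex \<open>x\<close> along a path with monomial \<open>\<tau> x\<close> conjugates the Laplacian by a diagonal
  matrix: the edge from \<open>a\<close> to \<open>b\<close> is dragged along at both ends.\<close>

lemma edge_matrix_gauge:
  "mon (- \<tau> v) * edge_matrix a b s \<mu> v w * mon (\<tau> w) = edge_matrix a b s (\<mu> - \<tau> a + \<tau> b) v w"
proof -
  have 1: "of_bool (v = x) * mon (- \<tau> v) = of_bool (v = x) * mon (- \<tau> x)"
    and 2: "of_bool (w = x) * mon (\<tau> w) = of_bool (w = x) * mon (\<tau> x)" for x
    by auto
  have "mon (- \<tau> v) * edge_matrix a b s \<mu> v w * mon (\<tau> w) = of_int s *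
     ((of_bool (v = a) * mon (- \<tau> v)) * (of_bool (w = a) * mon (\<tau> w))
      + (of_bool (v = b) * mon (- \<tau> v)) * (of_bool (w = b) * mon (\<tau> w))
      - (of_bool (v = a) * mon (- \<tau> v)) * (of_bool (w = b) * mon (\<tau> w)) * mon \<mu>
      - (of_bool (v = b) * mon (- \<tau> v)) * (of_bool (w = a) * mon (\<tau> w)) * mon (- \<mu>))"
    unfolding edge_matrix_def by (simp only: algebra_simps)
  also have "\<dots> = of_int s *
     (of_bool (v = a) * of_bool (w = a) * (mon (- \<tau> a) * mon (\<tau> a))
      + of_bool (v = b) * of_bool (w = b) * (mon (- \<tau> b) * mon (\<tau> b))
      - of_bool (v = a) * of_bool (w = b) * (mon (- \<tau> a) * mon (\<tau> b) * mon \<mu>)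
      - of_bool (v = b) * of_bool (w = a) * (mon (- \<tau> b) * mon (\<tau> a) * mon (- \<mu>)))"
    unfolding 1 2 by (simp only: algebra_simps)
  also have "\<dots> = edge_matrix a b s (\<mu> - \<tau> a + \<tau> b) v w"
    unfolding edge_matrix_def mono_mult by (simp add: algebra_simps)
  finally show ?thesis .
qed

definition edge_laplacian ::
    "'a::t2_space chart set \<Rightarrow> nat \<Rightarrow> (sympl_var \<Rightarrow> real \<Rightarrow> 'a) \<Rightarrow> ('v, 'e, 'a) sgraph \<Rightarrow> 'e \<times> bool
     \<Rightarrow> 'v \<Rightarrow> 'v \<Rightarrow> laurent" where
  "edge_laplacian A g c G d =
     edge_matrix (dsrc G d) (dtgt G d) (dsign G d) (path_monomial A g c (dpath G d))"

text \<open>Both directions of an edge give the same matrix, so each edge may be read in whichever direction a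
  move describes it.\<close>

lemma edge_laplacian_orientation: "edge_laplacian A g c G (e, b) = edge_laplacian A g c G (e, b')"
  by (cases b; cases b')
     (simp_all add: edge_matrix_swap edge_laplacian_def dsrc_def dtgt_def dsign_def dpath_def path_monomial_reversepath)

text \<open>The sums in the Laplacian run over directed edges; grouping the two directions of each edge turns
  them into sums over edges.\<close>

lemma sum_dedges:
  fixes f :: "'e \<times> bool \<Rightarrow> 'r::comm_ring_1"
  assumes "finite (edges G)"
  shows "(\<Sum>d | d \<in> dedges G \<and> P d. f d) =
      (\<Sum>e\<in>edges G. of_bool (P (e, True)) * f (e, True) + of_bool (P (e, False)) * f (e, False))"
proof -
  have "(\<Sum>d | d \<in> dedges G \<and> P d. f d) = (\<Sum>d\<in>edges G \<times> UNIV. if P d then f d else 0)"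
    using assms by (subst sum.inter_filter [symmetric]) (auto simp: dedges_def intro!: sum.cong)
  also have "\<dots> = (\<Sum>e\<in>edges G. \<Sum>b\<in>UNIV. if P (e, b) then f (e, b) else 0)"
    by (simp add: sum.cartesian_product)
  also have "\<dots> = (\<Sum>e\<in>edges G. of_bool (P (e, True)) * f (e, True) + of_bool (P (e, False)) * f (e, False))"
    by (rule sum.cong) (auto simp: UNIV_bool)
  finally show ?thesis .
qed

lemma laplacian_entry_eq_sum:
  assumes "finite (edges G)"
  shows "laplacian_entry A g c G v w = (\<Sum>e\<in>edges G. edge_laplacian A g c G (e, True) v w)"
proof -
  note split = sum_dedges [OF assms]
  show ?thesis
  proof (cases "v = w")
    case True
    then show ?thesis
      unfolding laplacian_entry_def adjacency_entry_def signed_degree_def split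
      by (auto simp: sum_subtractf [symmetric] edge_laplacian_def edge_matrix_def dsrc_def dtgt_def dsign_def
          dpath_def connection_def path_monomial_reversepath algebra_simps intro!: sum.cong)
  next
    case False
    then show ?thesis
      unfolding laplacian_entry_def adjacency_entry_def split
      by (auto simp: sum_negf [symmetric] edge_laplacian_def edge_matrix_def dsrc_def dtgt_def dsign_def
          dpath_def connection_def path_monomial_reversepath algebra_simps intro!: sum.cong)
  qed
qed

lemma laplacian_module_eq_cokernel:
  "laplacian_module A g c G = cokernel_module g (verts G) (verts G) (laplacian_entry A g c G)"
  by (simp add: laplacian_module_def cokernel_module_def row_span_def carrier_free_module)

lemma matrix_over_laplacian:
  assumes "finite (edges G)"
  shows "matrix_over g X Y (laplacian_entry A g c G)"
  unfolding laplacian_entry_eq_sum [OF assms] edge_laplacian_def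
  by (auto intro!: laurent_sum edge_matrix_in_laurent_ring keys_path_monomial [THEN subsetD])

lemma edge_laplacian_same_edge:
  "same_edge G G' e \<Longrightarrow> edge_laplacian A g c G' (e, b) = edge_laplacian A g c G (e, b)"
  by (simp add: same_edge_def edge_laplacian_def dsrc_def dtgt_def dsign_def dpath_def)

lemma laplacian_entry_outside:
  assumes "signed_graph_in S A g c G" "x \<notin> verts G"
  shows "laplacian_entry A g c G x y = 0" "laplacian_entry A g c G y x = 0"
proof -
  have "x \<noteq> etail G e \<and> x \<noteq> ehead G e" if "e \<in> edges G" for e
    using assms that by (auto simp: signed_graph_in_def)
  moreover have "finite (edges G)"
    using assms by (simp add: signed_graph_in_def)
  ultimately show "laplacian_entry A g c G x y = 0" "laplacian_entry A g c G y x = 0"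
    by (auto simp: laplacian_entry_eq_sum edge_laplacian_def dsrc_def dtgt_def edge_matrix_outside intro!: sum.neutral)
qed

lemma signed_graph_in_dpath:
  assumes "signed_graph_in S A g c G" "fst d \<in> edges G"
  shows "admissible_path S A g c (dpath G d)" "pathstart (dpath G d) = vpos G (dsrc G d)"
    "pathfinish (dpath G d) = vpos G (dtgt G d)" "dsign G d \<in> {1, -1}"
    "dsrc G d \<in> verts G" "dtgt G d \<in> verts G"
  using assms by (auto simp: signed_graph_in_def dpath_def dsrc_def dtgt_def dsign_def admissible_path_reversepath)

section \<open>Leaves, contractible loops and cancelling parallel edges\<close>

lemma signed_graph_in_finite:
  assumes "signed_graph_in S A g c G"
  shows "finite (verts G)" "finite (edges G)"
  using assms by (simp_all add: signed_graph_in_def)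

lemma sum_same_edges:
  assumes "\<forall>e\<in>E. same_edge G G' e"
  shows "(\<Sum>e\<in>E. edge_laplacian A g c G' (e, True) x y) = (\<Sum>e\<in>E. edge_laplacian A g c G (e, True) x y)"
  by (rule sum.cong) (use assms in \<open>simp_all add: edge_laplacian_same_edge [of G G']\<close>)

lemma laplacian_modules_isomorphic_sym:
  assumes "modules_isomorphic (laurent_ring g) (laplacian_module A g c G) N" "finite (edges G)"
  shows "modules_isomorphic (laurent_ring g) N (laplacian_module A g c G)"
  using assms(1) unfolding laplacian_module_eq_cokernel
  by (rule cokernel_modules_isomorphic_sym) (rule matrix_over_laplacian [OF assms(2)])

lemma of_int_sign_square: "s \<in> {1, -1} \<Longrightarrow> of_int s * of_int s = (1::'r::ring_1)"
  by auto

text \<open>The pivot is at the new vertex, so the isomorphism is found from the larger graph to the smaller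
  one.\<close>

lemma move_I_vertex_isomorphic:
  assumes G: "signed_graph_in S A g c G" and G': "signed_graph_in S A g c G'" and "move_I_vertex G G'"
  shows "modules_isomorphic (laurent_ring g) (laplacian_module A g c G) (laplacian_module A g c G')"
proof -
  obtain w e b where w: "w \<notin> verts G" and e: "e \<notin> edges G"
    and verts': "verts G' = insert w (verts G)" and edges': "edges G' = insert e (edges G)"
    and same: "unchanged (verts G) (edges G) G G'"
    and src: "dsrc G' (e, b) = w" and tgt: "dtgt G' (e, b) \<in> verts G"
    using assms(3) unfolding move_I_vertex_def by blast
  define s where "s = dsign G' (e, b)"
  define t where "t = dtgt G' (e, b)"
  define \<mu> where "\<mu> = path_monomial A g c (dpath G' (e, b))"
  have s: "of_int s * of_int s = (1 :: laurent)"
    using signed_graph_in_dpath(4) [OF G', of "(e, b)"] edges' by (intro of_int_sign_square) (simp add: s_def)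
  have wt: "w \<noteq> t" using w tgt t_def by blast
  have L': "laplacian_entry A g c G' x y = laplacian_entry A g c G x y + edge_matrix w t s \<mu> x y" for x y
    using edge_laplacian_orientation [of A g c G' e True b] e sum_same_edges [of "edges G" G G' A g c x y] same
      signed_graph_in_finite(2) [OF G] signed_graph_in_finite(2) [OF G']
    by (simp add: laplacian_entry_eq_sum edges' unchanged_def edge_laplacian_def s_def t_def \<mu>_def src)
  have "modules_isomorphic (laurent_ring g) (laplacian_module A g c G')
      (cokernel_module g (verts G' - {w}) (verts G' - {w}) (laplacian_entry A g c G))"
    unfolding laplacian_module_eq_cokernel
  proof (rule cokernel_module_pivot)
    show "matrix_over g (verts G') (verts G') (laplacian_entry A g c G')"
      by (rule matrix_over_laplacian [OF signed_graph_in_finite(2) [OF G']])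
    show "laplacian_entry A g c G' w w * of_int s = 1"
      using laplacian_entry_outside(1) [OF G w] wt s by (simp add: L' edge_matrix_def)
    show "laplacian_entry A g c G x y = laplacian_entry A g c G' x y -
        laplacian_entry A g c G' x w * of_int s * laplacian_entry A g c G' w y"
      if "x \<in> verts G' - {w}" "y \<in> verts G' - {w}" for x y
    proof -
      have "edge_matrix w t s \<mu> x y = of_int s * (of_bool (x = t) * of_bool (y = t))"
        using that by (simp add: edge_matrix_def)
      moreover have "laplacian_entry A g c G' x w = - (of_int s * of_bool (x = t) * mon (- \<mu>))"
        "laplacian_entry A g c G' w y = - (of_int s * of_bool (y = t) * mon \<mu>)"
        using that laplacian_entry_outside [OF G w] wt by (simp_all add: L' edge_matrix_def)
      moreover have "mon \<mu> * mon (- \<mu>) = 1" by (simp add: mult_single)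
      ultimately show ?thesis
        using s by (auto simp: L' of_bool_def algebra_simps)
    qed
  qed (use verts' signed_graph_in_finite [OF G'] in \<open>simp_all add: laurent_of_int\<close>)
  then have "modules_isomorphic (laurent_ring g) (laplacian_module A g c G') (laplacian_module A g c G)"
    using verts' w by (simp add: laplacian_module_eq_cokernel)
  then show ?thesis
    using signed_graph_in_finite(2) [OF G'] by (rule laplacian_modules_isomorphic_sym)
qed

lemma laplacian_module_eqI:
  assumes "verts G = verts G'" "\<And>x y. laplacian_entry A g c G x y = laplacian_entry A g c G' x y"
  shows "laplacian_module A g c G = laplacian_module A g c G'"
  unfolding laplacian_module_eq_cokernel assms(1) by (rule cokernel_module_cong) (rule assms(2))

lemma move_I_loop_isomorphic:
  assumes c: "symplectic_basis S A g c"
    and G: "signed_graph_in S A g c G" and G': "signed_graph_in S A g c G'" and "move_I_loop S G G'"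
  shows "modules_isomorphic (laurent_ring g) (laplacian_module A g c G) (laplacian_module A g c G')"
proof -
  obtain v e where v: "v \<in> verts G" and e: "e \<notin> edges G"
    and verts': "verts G' = verts G" and edges': "edges G' = insert e (edges G)"
    and same: "unchanged (verts G) (edges G) G G'"
    and ends: "etail G' e = v" "ehead G' e = v"
    and hom: "homotopic_paths S (epath G' e) (\<lambda>_. vpos G v)"
    using assms(4) unfolding move_I_loop_def by blast
  have off: "\<forall>u\<in>vars g. vpos G v \<notin> range (c u)" and "vpos G v \<in> S"
    using G v by (auto simp: signed_graph_in_def)
  then have "admissible_path S A g c (\<lambda>_. vpos G v)"
    by (auto simp: admissible_path_def transverse_def meetings_def path_def path_image_def pathstart_def
        pathfinish_def image_iff Bex_def intro!: continuous_intros)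
  then have "path_monomial A g c (epath G' e) = 0"
    using path_monomial_homotopic_paths [OF c hom] path_monomial_const [OF off] G' edges'
    by (simp add: signed_graph_in_def)
  then have "edge_laplacian A g c G' (e, True) x y = 0" for x y
    by (simp add: edge_laplacian_def edge_matrix_def dsrc_def dtgt_def dpath_def ends)
  then have "laplacian_entry A g c G x y = laplacian_entry A g c G' x y" for x y
    using e same sum_same_edges [of "edges G" G G' A g c x y]
      signed_graph_in_finite(2) [OF G] signed_graph_in_finite(2) [OF G']
    by (simp add: laplacian_entry_eq_sum edges' unchanged_def)
  then show ?thesis
    using laplacian_module_eqI [of G G' A g c] verts' modules_isomorphic_refl by metis
qed

lemma move_II_parallel_isomorphic:
  assumes c: "symplectic_basis S A g c"
    and G: "signed_graph_in S A g c G" and G': "signed_graph_in S A g c G'" and "move_II_parallel S G G'"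
  shows "modules_isomorphic (laurent_ring g) (laplacian_module A g c G) (laplacian_module A g c G')"
proof -
  obtain e f b where new: "e \<notin> edges G" "f \<notin> edges G" "e \<noteq> f"
    and verts': "verts G' = verts G" and edges': "edges G' = edges G \<union> {e, f}"
    and same: "unchanged (verts G) (edges G) G G'"
    and ends: "dsrc G' (f, b) = etail G' e" "dtgt G' (f, b) = ehead G' e"
    and hom: "homotopic_paths S (epath G' e) (dpath G' (f, b))"
    and sign: "esign G' f = - esign G' e"
    using assms(4) unfolding move_II_parallel_def by blast
  have "path_monomial A g c (epath G' e) = path_monomial A g c (dpath G' (f, b))"
    using hom signed_graph_in_dpath(1) [OF G', of "(f, b)"] signed_graph_in_dpath(1) [OF G', of "(e, True)"] edges'
    by (intro path_monomial_homotopic_paths [OF c]) (auto simp: dpath_def)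
  then have "edge_laplacian A g c G' (f, b) x y = - edge_laplacian A g c G' (e, True) x y" for x y
    unfolding edge_laplacian_def ends
    by (simp add: edge_matrix_def dsign_def sign dsrc_def dtgt_def dpath_def)
  then have "edge_laplacian A g c G' (f, True) x y + edge_laplacian A g c G' (e, True) x y = 0" for x y
    using edge_laplacian_orientation [of A g c G' f True b] by simp
  moreover have "edges G' = insert f (insert e (edges G))"
    using edges' by auto
  ultimately have "laplacian_entry A g c G x y = laplacian_entry A g c G' x y" for x y
    using new same sum_same_edges [of "edges G" G G' A g c x y]
      signed_graph_in_finite(2) [OF G] signed_graph_in_finite(2) [OF G']
    by (simp add: laplacian_entry_eq_sum unchanged_def add.assoc [symmetric])
  then show ?thesis
    using laplacian_module_eqI [of G G' A g c] verts' modules_isomorphic_refl by metis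
qed

section \<open>Contracting a path of two edges of opposite signs\<close>

text \<open>Identifying two vertices adds their rows and their columns.  Here \<open>z\<close> is the vertex that gets
  absorbed, primes denote images under the identification, and \<open>p\<close> indicates whether \<open>i\<close> is the vertex that
  absorbs \<open>z\<close>; likewise \<open>q\<close> for \<open>j\<close>.\<close>

lemma edge_matrix_merge:
  fixes p q :: laurent
  assumes "of_bool (i' = a') = of_bool (i = a) + p * of_bool (z = a)"
    and "of_bool (i' = b') = of_bool (i = b) + p * of_bool (z = b)"
    and "of_bool (j' = a') = of_bool (j = a) + q * of_bool (z = a)"
    and "of_bool (j' = b') = of_bool (j = b) + q * of_bool (z = b)"
  shows "edge_matrix a' b' s \<mu> i' j' =
    edge_matrix a b s \<mu> i j + p * edge_matrix a b s \<mu> z j + q * edge_matrix a b s \<mu> i z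
      + p * q * edge_matrix a b s \<mu> z z"
  unfolding edge_matrix_def assms by (simp only: algebra_simps)

text \<open>The algebra of the contraction, after both connections on the path \<open>v1, w, v2\<close> have been made
  trivial.  The row \<open>w\<close> is \<open>s (v2 - v1)\<close>, so a pivot at \<open>(w, v1)\<close> replaces \<open>v1\<close> by \<open>v2\<close>; after it
  the entry at \<open>(v1, w)\<close> is \<open>-s\<close>, and a pivot there removes \<open>w\<close> together with the relation \<open>v1\<close>.  The matrix
  \<open>M\<close> collects the other edges; \<open>N\<close> is obtained from it by identifying \<open>v1\<close> with \<open>v2\<close>.\<close>

lemma cokernel_module_path_pivot:
  fixes M :: "'v \<Rightarrow> 'v \<Rightarrow> laurent"
  assumes fin: "finite X" and M: "matrix_over g X X M" and w: "w \<in> X" "v1 \<in> X" "v2 \<in> X"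
    and distinct: "w \<noteq> v1" "w \<noteq> v2" "v1 \<noteq> v2" and s: "s \<in> {1, -1}"
    and outside: "\<And>y. M w y = 0" "\<And>y. M y w = 0"
    and L: "\<And>x y. x \<in> X \<Longrightarrow> y \<in> X \<Longrightarrow>
      L x y = M x y + edge_matrix w v1 s 0 x y + edge_matrix w v2 (- s) 0 x y"
    and N: "\<And>x y. x \<in> X - {w, v1} \<Longrightarrow> y \<in> X - {w, v1} \<Longrightarrow>
      N x y = M x y + of_bool (x = v2) * M v1 y + of_bool (y = v2) * M x v1
        + of_bool (x = v2) * of_bool (y = v2) * M v1 v1"
  shows "modules_isomorphic (laurent_ring g) (cokernel_module g X X L)
    (cokernel_module g (X - {w, v1}) (X - {w, v1}) N)"
proof -
  have ss: "of_int s * of_int s = (1 :: laurent)"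
    using s by (rule of_int_sign_square)
  have L_row: "L w y = of_int s * (of_bool (y = v2) - of_bool (y = v1))" if "y \<in> X" for y
    using that w distinct by (simp add: L outside edge_matrix_def algebra_simps)
  have L_col: "L x w = of_int s * (of_bool (x = v2) - of_bool (x = v1))" if "x \<in> X" for x
    using that w distinct by (simp add: L outside edge_matrix_def algebra_simps)
  have L_rest: "L x y = M x y + of_int s * (of_bool (x = v1) * of_bool (y = v1) - of_bool (x = v2) * of_bool (y = v2))"
    if "x \<in> X - {w}" "y \<in> X - {w}" for x y
    using that distinct by (simp add: L edge_matrix_def algebra_simps)
  \<comment> \<open>the first pivot adds the column \<open>v1\<close> to the column \<open>v2\<close>\<close>
  define L1 where "L1 x y = L x y + of_bool (y = v2) * L x v1" for x y
  have L_matrix: "matrix_over g X X L"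
    using M by (auto simp: L intro!: laurent_add edge_matrix_in_laurent_ring)
  have "modules_isomorphic (laurent_ring g) (cokernel_module g X X L)
      (cokernel_module g (X - {w}) (X - {v1}) L1)"
  proof (rule cokernel_module_pivot [where u = "- of_int s", OF fin L_matrix w(1,2)])
    show "L w v1 * - of_int s = 1"
      using w distinct ss by (simp add: L_row)
    show "L1 x y = L x y - L x v1 * - of_int s * L w y" if "x \<in> X - {w}" "y \<in> X - {v1}" for x y
    proof -
      have "L x v1 * - of_int s * L w y = - (of_int s * of_int s) * (of_bool (y = v2) * L x v1)"
        using that by (simp add: L_row)
      then show ?thesis
        by (simp add: L1_def ss)
    qed
  qed (simp add: laurent_uminus laurent_of_int)
  moreover have "modules_isomorphic (laurent_ring g) (cokernel_module g (X - {w}) (X - {v1}) L1)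
      (cokernel_module g (X - {w} - {v1}) (X - {v1} - {w}) N)"
  proof (rule cokernel_module_pivot [where u = "- of_int s"])
    show "matrix_over g (X - {w}) (X - {v1}) L1"
      using L_matrix w by (auto simp: L1_def of_bool_def intro!: laurent_closed)
    show "L1 v1 w * - of_int s = 1"
      using w distinct ss by (simp add: L1_def L_col)
    show "N x y = L1 x y - L1 x w * - of_int s * L1 v1 y"
      if "x \<in> X - {w} - {v1}" "y \<in> X - {v1} - {w}" for x y
    proof -
      have "L1 x w = of_int s * of_bool (x = v2)"
        using that distinct by (simp add: L1_def L_col)
      then have "L1 x w * - of_int s = - (of_int s * of_int s) * of_bool (x = v2)"
        by simp
      then have pivot: "L1 x w * - of_int s = - of_bool (x = v2)"
        by (simp add: ss)
      have row: "L1 v1 y = M v1 y + of_bool (y = v2) * (M v1 v1 + of_int s)"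
        using that w distinct by (simp add: L1_def L_rest of_bool_def)
      have entry: "L1 x y = M x y - of_int s * (of_bool (x = v2) * of_bool (y = v2)) + of_bool (y = v2) * M x v1"
        using that w distinct by (simp add: L1_def L_rest algebra_simps)
      have "N x y = M x y + of_bool (x = v2) * M v1 y + of_bool (y = v2) * M x v1
          + of_bool (x = v2) * of_bool (y = v2) * M v1 v1"
        using that by (intro N) auto
      then show ?thesis
        unfolding pivot row entry by (simp add: algebra_simps)
    qed
  qed (use fin w distinct in \<open>simp_all add: laurent_uminus laurent_of_int\<close>)
  moreover have "X - {w} - {v1} = X - {w, v1}" "X - {v1} - {w} = X - {w, v1}"
    by auto
  ultimately show ?thesis
    using modules_isomorphic_trans by metis
qed

text \<open>The diagonal entry at the middle vertex is zero, so it cannot be eliminated directly.  The Laplacian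
  is rescaled by the traces of the vertices, reduced by two pivots, and relabelled.\<close>

lemma move_II_contract_isomorphic:
  assumes c: "symplectic_basis S A g c"
    and G: "signed_graph_in S A g c G" and G': "signed_graph_in S A g c G'"
    and move: "move_II_contract S A g c G G'"
  shows "modules_isomorphic (laurent_ring g) (laplacian_module A g c G) (laplacian_module A g c G')"
proof -
  obtain w d1 d2 u q where w: "w \<in> verts G" "incident G w = {fst d1, fst d2}" "fst d1 \<noteq> fst d2"
    and src: "dsrc G d1 = w" "dsrc G d2 = w"
    and distinct': "dtgt G d1 \<noteq> w" "dtgt G d2 \<noteq> w" "dtgt G d1 \<noteq> dtgt G d2"
    and sign: "dsign G d2 = - dsign G d1"
    and u': "u \<notin> verts G - {dtgt G d1, w, dtgt G d2}" "verts G' = insert u (verts G - {dtgt G d1, w, dtgt G d2})"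
    and edges': "edges G' = edges G - incident G w"
    and q: "admissible_path S A g c q" "pathstart q = vpos G w" "pathfinish q = vpos G' u"
    and same': "unchanged (verts G - {dtgt G d1, w, dtgt G d2})
      {e \<in> edges G - incident G w. {etail G e, ehead G e} \<inter> {dtgt G d1, dtgt G d2} = {}} G G'"
    and changed': "\<forall>e\<in>edges G - incident G w. {etail G e, ehead G e} \<inter> {dtgt G d1, dtgt G d2} \<noteq> {} \<longrightarrow>
      etail G' e = (if etail G e = dtgt G d1 \<or> etail G e = dtgt G d2 then u else etail G e) \<and>
      ehead G' e = (if ehead G e = dtgt G d1 \<or> ehead G e = dtgt G d2 then u else ehead G e) \<and>
      esign G' e = esign G e \<and>
      homotopic_paths S (epath G' e)
        ((\<lambda>x p. if x = dtgt G d1 \<or> x = dtgt G d2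
              then p +++ (if x = dtgt G d1 then reversepath (dpath G d1) +++ q else reversepath (dpath G d2) +++ q) else p)
          (ehead G e)
          ((\<lambda>x p. if x = dtgt G d1 \<or> x = dtgt G d2
              then reversepath (if x = dtgt G d1 then reversepath (dpath G d1) +++ q else reversepath (dpath G d2) +++ q) +++ p
              else p) (etail G e) (epath G e)))"
    using move unfolding move_II_contract_def Let_def
    by (elim exE conjE) (rule that; assumption)
  define v1 where "v1 = dtgt G d1"
  define v2 where "v2 = dtgt G d2"
  define V where "V = verts G - {v1, w, v2}"
  define E where "E = edges G - incident G w"
  note v_def = v1_def v2_def and VE = V_def E_def
  note distinct = distinct' [folded v_def] and u = u' [folded v_def, folded V_def]
    and edges' = edges' [folded E_def] and same = same' [folded v_def, folded VE]
    and changed = changed' [folded v_def, folded VE, rule_format]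
  define trace where "trace x = (if x = v1 then reversepath (dpath G d1) +++ q else reversepath (dpath G d2) +++ q)" for x
  define m where "m x = (if x = v1 \<or> x = v2 then u else x)" for x
  define s where "s = dsign G d1"
  let ?pm = "path_monomial A g c"
  \<comment> \<open>with \<open>\<tau> w\<close> the monomial of \<open>q\<close>, the connection from \<open>w\<close> to \<open>v\<^sub>i\<close> becomes trivial after rescaling\<close>
  define \<tau> where "\<tau> x = (if x = v1 \<or> x = v2 then ?pm (trace x) else if x = w then ?pm q else 0)" for x
  have inc: "fst d1 \<in> edges G" "fst d2 \<in> edges G"
    using w(2) by (auto simp: incident_def)
  note d1 = signed_graph_in_dpath [OF G inc(1)] and d2 = signed_graph_in_dpath [OF G inc(2)]
  have v_verts: "v1 \<in> verts G" "v2 \<in> verts G"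
    using d1(6) d2(6) by (simp_all add: v_def)
  have trace: "admissible_path S A g c (trace x)" "pathstart (trace x) = vpos G x" "pathfinish (trace x) = vpos G' u"
    if "x = v1 \<or> x = v2" for x
    using that d1(1-3) d2(1-3) q src
    by (auto simp: trace_def v_def admissible_path_joinpaths admissible_path_reversepath)
  have pm_trace: "?pm (trace v1) = ?pm q - ?pm (dpath G d1)" "?pm (trace v2) = ?pm q - ?pm (dpath G d2)"
    using d1(1-3) d2(1-3) q src distinct
    by (auto simp: trace_def path_monomial_joinpaths [of S] admissible_path_reversepath path_monomial_reversepath)
  have E_ends: "etail G e \<in> verts G - {w}" "ehead G e \<in> verts G - {w}" if "e \<in> E" for e
    using that G VE by (auto simp: signed_graph_in_def incident_def)
  have E_edge: "dsrc G' (e, True) = m (dsrc G (e, True))" "dtgt G' (e, True) = m (dtgt G (e, True))"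
    "dsign G' (e, True) = dsign G (e, True)"
    "?pm (dpath G' (e, True)) = ?pm (dpath G (e, True)) - \<tau> (dsrc G (e, True)) + \<tau> (dtgt G (e, True))"
    if e: "e \<in> E" for e
  proof -
    define a b where "a = etail G e" and "b = ehead G e"
    have e_G: "e \<in> edges G" and e_G': "e \<in> edges G'" using e VE edges' by auto
    have p: "admissible_path S A g c (epath G e)" "pathstart (epath G e) = vpos G a" "pathfinish (epath G e) = vpos G b"
      and p': "admissible_path S A g c (epath G' e)"
      using G G' e_G e_G' by (auto simp: signed_graph_in_def a_def b_def)
    have ab: "a \<noteq> w" "b \<noteq> w" using E_ends [OF e] by (auto simp: a_def b_def)
    have "etail G' e = m a \<and> ehead G' e = m b \<and> esign G' e = esign G e \<and>
      ?pm (epath G' e) = ?pm (epath G e) - \<tau> a + \<tau> b"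
    proof (cases "{a, b} \<inter> {v1, v2} = {}")
      case True
      then have "same_edge G G' e"
        using same e by (auto simp: unchanged_def a_def b_def)
      then show ?thesis
        using True ab by (auto simp: same_edge_def m_def \<tau>_def a_def b_def)
    next
      case False
      \<comment> \<open>the edge dragged at its tail, and then at its head\<close>
      define p1 where "p1 = (if a = v1 \<or> a = v2 then reversepath (trace a) +++ epath G e else epath G e)"
      define p2 where "p2 = (if b = v1 \<or> b = v2 then p1 +++ trace b else p1)"
      have p1: "admissible_path S A g c p1" "pathfinish p1 = vpos G b" "?pm p1 = ?pm (epath G e) - \<tau> a"
        using p trace [of a] ab path_monomial_joinpaths [of S A g c "reversepath (trace a)" "epath G e"]
        by (auto simp: p1_def \<tau>_def admissible_path_joinpaths admissible_path_reversepath path_monomial_reversepath)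
      have p2: "admissible_path S A g c p2" "?pm p2 = ?pm (epath G e) - \<tau> a + \<tau> b"
        using p1 trace [of b] ab path_monomial_joinpaths [of S A g c p1 "trace b"]
        by (auto simp: p2_def \<tau>_def admissible_path_joinpaths)
      have "homotopic_paths S (epath G' e) p2"
        using changed [OF e] False by (auto simp: p1_def p2_def trace_def a_def b_def)
      then have "?pm (epath G' e) = ?pm p2"
        by (rule path_monomial_homotopic_paths [OF c _ p' p2(1)])
      then show ?thesis
        using changed [OF e] False p2(2) by (auto simp: m_def a_def b_def)
    qed
    then show "dsrc G' (e, True) = m (dsrc G (e, True))" "dtgt G' (e, True) = m (dtgt G (e, True))"
      "dsign G' (e, True) = dsign G (e, True)"
      "?pm (dpath G' (e, True)) = ?pm (dpath G (e, True)) - \<tau> (dsrc G (e, True)) + \<tau> (dtgt G (e, True))"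
      by (simp_all add: dsrc_def dtgt_def dsign_def dpath_def a_def b_def)
  qed
  define T where "T e = edge_matrix (dsrc G (e, True)) (dtgt G (e, True)) (dsign G (e, True))
      (?pm (dpath G (e, True)) - \<tau> (dsrc G (e, True)) + \<tau> (dtgt G (e, True)))" for e
  define M where "M x y = (\<Sum>e\<in>E. T e x y)" for x y
  define L where "L x y = mon (- \<tau> x) * laplacian_entry A g c G x y * mon (\<tau> y)" for x y
  define N where "N x y = laplacian_entry A g c G' (m x) (m y)" for x y
  have edges: "edges G = insert (fst d1) (insert (fst d2) E)" "fst d1 \<notin> insert (fst d2) E" "fst d2 \<notin> E" "finite E"
    using VE(2) w(2,3) inc signed_graph_in_finite(2) [OF G] by auto
  have \<tau>_simps: "\<tau> w = ?pm q" "\<tau> v1 = ?pm q - ?pm (dpath G d1)" "\<tau> v2 = ?pm q - ?pm (dpath G d2)"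
    using distinct by (simp_all add: \<tau>_def pm_trace)
  have keys_\<tau>: "Poly_Mapping.keys (\<tau> x) \<subseteq> vars g" for x
    using keys_path_monomial [of A g c] by (simp add: \<tau>_def)
  have L_eq: "L x y = M x y + edge_matrix w v1 s 0 x y + edge_matrix w v2 (- s) 0 x y" for x y
  proof -
    have "mon (- \<tau> x) * edge_laplacian A g c G d x y * mon (\<tau> y) =
        edge_matrix (dsrc G d) (dtgt G d) (dsign G d) (?pm (dpath G d) - \<tau> (dsrc G d) + \<tau> (dtgt G d)) x y" for d
      unfolding edge_laplacian_def by (rule edge_matrix_gauge)
    note gauge = this
    have "L x y = mon (- \<tau> x) * edge_laplacian A g c G (fst d1, snd d1) x y * mon (\<tau> y)
        + mon (- \<tau> x) * edge_laplacian A g c G (fst d2, snd d2) x y * mon (\<tau> y)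
        + (\<Sum>e\<in>E. mon (- \<tau> x) * edge_laplacian A g c G (e, True) x y * mon (\<tau> y))"
      using edges edge_laplacian_orientation [of A g c G "fst d1" True "snd d1"]
        edge_laplacian_orientation [of A g c G "fst d2" True "snd d2"]
      by (simp add: L_def laplacian_entry_eq_sum sum_distrib_left sum_distrib_right distrib_left distrib_right add.assoc)
    then show ?thesis
      unfolding gauge prod.collapse by (simp add: src v_def [symmetric] sign s_def \<tau>_simps M_def T_def)
  qed
  have "w \<noteq> etail G e" "w \<noteq> ehead G e" if "e \<in> E" for e
    using E_ends [OF that] by auto
  then have outside: "M w y = 0" "M y w = 0" for y
    by (auto simp: M_def T_def dsrc_def dtgt_def edge_matrix_outside intro!: sum.neutral)
  have iso1: "modules_isomorphic (laurent_ring g) (laplacian_module A g c G) (cokernel_module g (verts G) (verts G) L)"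
    unfolding laplacian_module_eq_cokernel
  proof (rule cokernel_module_rescale [where m = "\<lambda>x. x" and n = "\<lambda>x. x"
        and \<sigma> = "\<lambda>x. mon (- \<tau> x)" and \<sigma>' = "\<lambda>x. mon (\<tau> x)" and \<tau> = "\<lambda>x. mon (\<tau> x)" and \<tau>' = "\<lambda>x. mon (- \<tau> x)"])
    show "matrix_over g (verts G) (verts G) (laplacian_entry A g c G)"
      by (rule matrix_over_laplacian [OF signed_graph_in_finite(2) [OF G]])
  qed (use keys_\<tau> in \<open>auto simp: bij_betw_def L_def mono_in_laurent_ring mono_mult\<close>)
  have iso2: "modules_isomorphic (laurent_ring g) (cokernel_module g (verts G) (verts G) L)
      (cokernel_module g (verts G - {w, v1}) (verts G - {w, v1}) N)"
  proof (rule cokernel_module_path_pivot [OF signed_graph_in_finite(1) [OF G] _ w(1) v_verts])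
    show "matrix_over g (verts G) (verts G) M"
    proof -
      have "Poly_Mapping.keys (?pm p - \<tau> a + \<tau> b) \<subseteq> vars g" for p a b
        using Poly_Mapping.keys_add [of "?pm p - \<tau> a" "\<tau> b"] Poly_Mapping.keys_diff [of "?pm p" "\<tau> a"]
          keys_path_monomial [of A g c p] keys_\<tau> [of a] keys_\<tau> [of b] by blast
      then show ?thesis
        by (auto simp: M_def T_def intro!: laurent_sum edge_matrix_in_laurent_ring)
    qed
    show "s \<in> {1, -1}" using d1(4) by (simp add: s_def)
    show "N x y = M x y + of_bool (x = v2) * M v1 y + of_bool (y = v2) * M x v1
        + of_bool (x = v2) * of_bool (y = v2) * M v1 v1"
      if xy: "x \<in> verts G - {w, v1}" "y \<in> verts G - {w, v1}" for x y
    proof -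
      have m_eq: "of_bool (m k = m a) = (of_bool (k = a) + of_bool (k = v2) * of_bool (v1 = a) :: laurent)"
        if "a \<in> verts G - {w}" "k \<in> verts G - {w, v1}" for a k
        using that u(1) VE(1) distinct by (auto simp: m_def)
      have merged: "edge_laplacian A g c G' (e, True) (m x) (m y) = T e x y + of_bool (x = v2) * T e v1 y
          + of_bool (y = v2) * T e x v1 + of_bool (x = v2) * of_bool (y = v2) * T e v1 v1" if e: "e \<in> E" for e
      proof -
        have ends: "dsrc G (e, True) \<in> verts G - {w}" "dtgt G (e, True) \<in> verts G - {w}"
          using E_ends [OF e] by (simp_all add: dsrc_def dtgt_def)
        show ?thesis
          unfolding edge_laplacian_def E_edge [OF e] T_def
          by (rule edge_matrix_merge [OF m_eq [OF ends(1) xy(1)] m_eq [OF ends(2) xy(1)]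
                m_eq [OF ends(1) xy(2)] m_eq [OF ends(2) xy(2)]])
      qed
      have "(\<Sum>e\<in>E. edge_laplacian A g c G' (e, True) (m x) (m y)) =
          (\<Sum>e\<in>E. T e x y + of_bool (x = v2) * T e v1 y + of_bool (y = v2) * T e x v1
            + of_bool (x = v2) * of_bool (y = v2) * T e v1 v1)"
      proof (rule sum.cong)
        fix e assume "e \<in> E"
        then show "edge_laplacian A g c G' (e, True) (m x) (m y) = T e x y + of_bool (x = v2) * T e v1 y
            + of_bool (y = v2) * T e x v1 + of_bool (x = v2) * of_bool (y = v2) * T e v1 v1"
          by (rule merged)
      qed (rule refl)
      moreover have "N x y = (\<Sum>e\<in>E. edge_laplacian A g c G' (e, True) (m x) (m y))"
        using edges(4) by (simp add: N_def laplacian_entry_eq_sum edges')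
      ultimately show ?thesis
        by (simp only: M_def sum.distrib sum_distrib_left)
    qed
  qed (use distinct outside L_eq in auto)
  have m_bij: "bij_betw m (verts G - {w, v1}) (verts G')"
  proof -
    have "verts G - {w, v1} = insert v2 V"
      using VE(1) v_verts distinct by auto
    then show ?thesis
      using u VE(1) by (auto simp: bij_betw_def inj_on_def m_def image_iff)
  qed
  have iso3: "modules_isomorphic (laurent_ring g) (cokernel_module g (verts G - {w, v1}) (verts G - {w, v1}) N)
      (laplacian_module A g c G')"
    unfolding laplacian_module_eq_cokernel
  proof (rule cokernel_module_rescale [OF m_bij m_bij, where \<sigma> = "\<lambda>_. 1" and \<sigma>' = "\<lambda>_. 1" and \<tau> = "\<lambda>_. 1" and \<tau>' = "\<lambda>_. 1"])
    show "matrix_over g (verts G - {w, v1}) (verts G - {w, v1}) N"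
      using matrix_over_laplacian [OF signed_graph_in_finite(2) [OF G'], where X = UNIV and Y = UNIV]
      by (simp add: N_def)
  qed (simp_all add: laurent_one N_def)
  show ?thesis
    by (rule modules_isomorphic_trans [OF iso1 modules_isomorphic_trans [OF iso2 iso3]])
qed

section \<open>Replacing a star by a triangle\<close>

text \<open>The Schur complement at the centre of a star, for arbitrary ends.  The elements \<open>a\<^sub>i\<close> and \<open>b\<^sub>i\<close>
  stand for the indicators that the row and the column belong to the \<open>i\<close>-th end, \<open>p\<^sub>i\<close> and \<open>q\<^sub>i\<close> for the
  connections of the \<open>i\<close>-th edge away from and towards the centre.  As the \<open>a\<^sub>i\<close> are independent variables, it does not matter
  whether ends coincide.\<close>

lemma star_triangle_identity:
  fixes a0 a1 a2 b0 b1 b2 p0 p1 p2 q0 q1 q2 s0 s1 s2 :: "'r::comm_ring_1"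
  assumes inv: "p0 * q0 = 1" "p1 * q1 = 1" "p2 * q2 = 1"
    and square: "s0 * s0 = 1" "s1 * s1 = 1" "s2 * s2 = 1"
    and mixed: "(s0 + s1 + s2) * s1 * s2 = - s0" "(s0 + s1 + s2) * s0 * s2 = - s1" "(s0 + s1 + s2) * s0 * s1 = - s2"
  shows "s0 * (a0 * b0) + s1 * (a1 * b1) + s2 * (a2 * b2)
      - (s0 * (a0 * q0) + s1 * (a1 * q1) + s2 * (a2 * q2)) * (s0 + s1 + s2)
        * (s0 * (b0 * p0) + s1 * (b1 * p1) + s2 * (b2 * p2)) =
    - s0 * (a1 * b1 + a2 * b2 - a1 * b2 * (q1 * p2) - a2 * b1 * (q2 * p1))
    - s1 * (a2 * b2 + a0 * b0 - a2 * b0 * (q2 * p0) - a0 * b2 * (q0 * p2))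
    - s2 * (a0 * b0 + a1 * b1 - a0 * b1 * (q0 * p1) - a1 * b0 * (q1 * p0))"
proof -
  let ?S = "s0 + s1 + s2"
  have "(s0 * (a0 * q0) + s1 * (a1 * q1) + s2 * (a2 * q2)) * ?S
        * (s0 * (b0 * p0) + s1 * (b1 * p1) + s2 * (b2 * p2)) =
      ?S * (s0 * s0) * (a0 * b0) * (p0 * q0) + ?S * (s1 * s1) * (a1 * b1) * (p1 * q1)
      + ?S * (s2 * s2) * (a2 * b2) * (p2 * q2)
      + (?S * s1 * s2) * (a1 * b2 * (q1 * p2) + a2 * b1 * (q2 * p1))
      + (?S * s0 * s2) * (a2 * b0 * (q2 * p0) + a0 * b2 * (q0 * p2))
      + (?S * s0 * s1) * (a0 * b1 * (q0 * p1) + a1 * b0 * (q1 * p0))"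
    by (simp only: algebra_simps)
  then show ?thesis
    unfolding inv square mixed by (simp add: algebra_simps)
qed

text \<open>With two signs equal and the third opposite, the sum is the repeated sign.\<close>

lemma unequal_signs:
  fixes s0 s1 s2 :: int
  assumes "s0 \<in> {1, -1}" "s1 \<in> {1, -1}" "s2 \<in> {1, -1}" and "\<not> (s0 = s1 \<and> s1 = s2)"
  shows "(s0 + s1 + s2) * s1 * s2 = - s0" "(s0 + s1 + s2) * s0 * s2 = - s1"
    "(s0 + s1 + s2) * s0 * s1 = - s2" "(s0 + s1 + s2) * (s0 + s1 + s2) = 1"
  using assms by auto

lemma sum_lessThan_3: "(\<Sum>i<3. f i) = f 0 + f 1 + f (2::nat)"
  by (simp add: numeral_3_eq_3 numeral_2_eq_2 add.assoc)

text \<open>A single pivot at the centre of the star, whose diagonal entry is the sum of the three signs.\<close>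

lemma move_III_isomorphic:
  assumes c: "symplectic_basis S A g c"
    and G: "signed_graph_in S A g c G" and G': "signed_graph_in S A g c G'" and move: "move_III S G G'"
  shows "modules_isomorphic (laurent_ring g) (laplacian_module A g c G) (laplacian_module A g c G')"
proof -
  obtain v i0 j0 and d :: "nat \<Rightarrow> _" and f :: "nat \<Rightarrow> _" where v: "v \<in> verts G"
    and star: "incident G v = (\<lambda>i. fst (d i)) ` {..<3}" "inj_on (\<lambda>i. fst (d i)) {..<3}"
    and ends: "\<forall>i<3. dsrc G (d i) = v \<and> dtgt G (d i) \<noteq> v"
    and signs: "i0 < 3" "j0 < 3" "dsign G (d i0) \<noteq> dsign G (d j0)"
    and f: "inj_on f {..<3}" "f ` {..<3} \<inter> (edges G - incident G v) = {}"
    and verts': "verts G' = verts G - {v}"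
    and edges': "edges G' = (edges G - incident G v) \<union> f ` {..<3}"
    and same: "unchanged (verts G - {v}) (edges G - incident G v) G G'"
    and triangle: "\<forall>i<3. esign G' (f i) = - dsign G (d i) \<and>
      (\<exists>b. dsrc G' (f i, b) = dtgt G (d ((i + 1) mod 3)) \<and> dtgt G' (f i, b) = dtgt G (d ((i + 2) mod 3)) \<and>
         homotopic_paths S (dpath G' (f i, b))
           (reversepath (dpath G (d ((i + 1) mod 3))) +++ dpath G (d ((i + 2) mod 3))))"
    using move unfolding move_III_def Let_def
    by (elim exE conjE) (rule that; assumption)
  define E where "E = edges G - incident G v"
  define t where "t i = dtgt G (d i)" for i
  define s where "s i = dsign G (d i)" for i
  define \<mu> where "\<mu> i = path_monomial A g c (dpath G (d i))" for i
  have inc: "fst (d i) \<in> edges G" if "i < 3" for i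
    using star(1) that by (auto simp: incident_def)
  note d = signed_graph_in_dpath [OF G inc]
  have t_v: "v \<noteq> t i" if "i < 3" for i using ends that by (auto simp: t_def)
  have s: "s i \<in> {1, -1}" if "i < 3" for i using d(4) [OF that] by (simp add: s_def)
  have finE: "finite E" using signed_graph_in_finite(2) [OF G] by (simp add: E_def)
  define M where "M x y = (\<Sum>e\<in>E. edge_laplacian A g c G (e, True) x y)" for x y
  have "v \<noteq> etail G e" "v \<noteq> ehead G e" if "e \<in> E" for e
    using that by (auto simp: E_def incident_def)
  then have outside: "M v y = 0" "M y v = 0" for y
    by (auto simp: M_def edge_laplacian_def dsrc_def dtgt_def edge_matrix_outside intro!: sum.neutral)
  have L: "laplacian_entry A g c G x y = M x y + (\<Sum>i<3. edge_matrix v (t i) (s i) (\<mu> i) x y)" for x y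
  proof -
    have "edges G = E \<union> (\<lambda>i. fst (d i)) ` {..<3}" "E \<inter> (\<lambda>i. fst (d i)) ` {..<3} = {}"
      using inc by (auto simp: E_def star(1))
    then have "laplacian_entry A g c G x y = M x y + (\<Sum>i<3. edge_laplacian A g c G (fst (d i), True) x y)"
      using finE signed_graph_in_finite(2) [OF G]
      by (simp add: laplacian_entry_eq_sum sum.union_disjoint M_def sum.reindex [OF star(2)] o_def)
    also have "(\<Sum>i<3. edge_laplacian A g c G (fst (d i), True) x y) = (\<Sum>i<3. edge_matrix v (t i) (s i) (\<mu> i) x y)"
    proof (rule sum.cong)
      fix i :: nat assume "i \<in> {..<3}"
      then have "dsrc G (d i) = v" using ends by simp
      moreover have "edge_laplacian A g c G (fst (d i), True) = edge_laplacian A g c G (d i)"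
        using edge_laplacian_orientation [of A g c G "fst (d i)" True "snd (d i)"] by simp
      ultimately show "edge_laplacian A g c G (fst (d i), True) x y = edge_matrix v (t i) (s i) (\<mu> i) x y"
        by (simp add: edge_laplacian_def t_def s_def \<mu>_def)
    qed (rule refl)
    finally show ?thesis .
  qed
  have triangle_edge: "edge_laplacian A g c G' (f i, True) =
      edge_matrix (t ((i + 1) mod 3)) (t ((i + 2) mod 3)) (- s i) (\<mu> ((i + 2) mod 3) - \<mu> ((i + 1) mod 3))"
    if i: "i < 3" for i
  proof -
    let ?j = "(i + 1) mod 3" and ?k = "(i + 2) mod 3"
    have jk: "?j < 3" "?k < 3" by simp_all
    obtain b where b: "esign G' (f i) = - s i" "dsrc G' (f i, b) = t ?j" "dtgt G' (f i, b) = t ?k"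
      and hom: "homotopic_paths S (dpath G' (f i, b)) (reversepath (dpath G (d ?j)) +++ dpath G (d ?k))"
      using triangle i unfolding s_def t_def by blast
    have join: "pathfinish (reversepath (dpath G (d ?j))) = pathstart (dpath G (d ?k))"
      using d(2) [OF jk(1)] d(2) [OF jk(2)] ends jk by simp
    have "f i \<in> edges G'" using edges' i by auto
    then have "admissible_path S A g c (dpath G' (f i, b))"
      using signed_graph_in_dpath(1) [OF G', of "(f i, b)"] by simp
    then have "path_monomial A g c (dpath G' (f i, b)) =
        path_monomial A g c (reversepath (dpath G (d ?j)) +++ dpath G (d ?k))"
      using d(1) [OF jk(1)] d(1) [OF jk(2)] join
      by (intro path_monomial_homotopic_paths [OF c hom]) (auto simp: admissible_path_joinpaths admissible_path_reversepath)
    also have "\<dots> = \<mu> ?k - \<mu> ?j"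
      using d(1) [OF jk(1)] d(1) [OF jk(2)] join
      by (simp add: path_monomial_joinpaths [of S] admissible_path_reversepath path_monomial_reversepath \<mu>_def)
    finally show ?thesis
      using edge_laplacian_orientation [of A g c G' "f i" True b] b
      by (simp add: edge_laplacian_def dsign_def)
  qed
  have L': "laplacian_entry A g c G' x y = M x y + (\<Sum>i<3. edge_matrix (t ((i + 1) mod 3)) (t ((i + 2) mod 3))
      (- s i) (\<mu> ((i + 2) mod 3) - \<mu> ((i + 1) mod 3)) x y)" for x y
  proof -
    have "M x y = (\<Sum>e\<in>E. edge_laplacian A g c G' (e, True) x y)"
      using same sum_same_edges [of E G G' A g c x y] by (simp add: M_def unchanged_def E_def)
    moreover have "edges G' = E \<union> f ` {..<3}" "E \<inter> f ` {..<3} = {}"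
      using edges' f(2) by (auto simp: E_def)
    ultimately have "laplacian_entry A g c G' x y = M x y + (\<Sum>i<3. edge_laplacian A g c G' (f i, True) x y)"
      using finE signed_graph_in_finite(2) [OF G']
      by (simp add: laplacian_entry_eq_sum sum.union_disjoint sum.reindex [OF f(1)] o_def)
    then show ?thesis by (simp add: triangle_edge)
  qed
  \<comment> \<open>the diagonal entry at the centre, which is its own inverse\<close>
  define \<sigma> :: laurent where "\<sigma> = of_int (s 0 + s 1 + s 2)"
  have not_all: "\<not> (s 0 = s 1 \<and> s 1 = s 2)"
  proof
    assume eq: "s 0 = s 1 \<and> s 1 = s 2"
    have "s i = s 0" if "i < 3" for i
    proof -
      have "i = 0 \<or> i = 1 \<or> i = 2" using that by linarith
      then show ?thesis using eq by auto
    qed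
    then show False using signs unfolding s_def by metis
  qed
  note sign_facts = unequal_signs [OF s s s not_all, simplified]
  have of_int_facts: "of_int (s i) * of_int (s i) = (1 :: laurent)" if "i < 3" for i
    using s [OF that] by (rule of_int_sign_square)
  have \<sigma>_facts: "\<sigma> * \<sigma> = 1" "\<sigma> * of_int (s 1) * of_int (s 2) = - of_int (s 0)"
    "\<sigma> * of_int (s 0) * of_int (s 2) = - of_int (s 1)" "\<sigma> * of_int (s 0) * of_int (s 1) = - of_int (s 2)"
    unfolding \<sigma>_def of_int_mult [symmetric] of_int_minus [symmetric] using sign_facts by simp_all
  have "modules_isomorphic (laurent_ring g) (cokernel_module g (verts G) (verts G) (laplacian_entry A g c G))
      (cokernel_module g (verts G - {v}) (verts G - {v}) (laplacian_entry A g c G'))"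
  proof (rule cokernel_module_pivot [OF signed_graph_in_finite(1) [OF G] _ v v])
    show "matrix_over g (verts G) (verts G) (laplacian_entry A g c G)"
      by (rule matrix_over_laplacian [OF signed_graph_in_finite(2) [OF G]])
    show "\<sigma> \<in> carrier (laurent_ring g)" by (simp only: \<sigma>_def laurent_of_int)
    show "laplacian_entry A g c G v v * \<sigma> = 1"
      using \<sigma>_facts(1) t_v [of 0] t_v [of 1] t_v [of 2]
      by (simp add: L outside sum_lessThan_3 edge_matrix_def \<sigma>_def)
    show "laplacian_entry A g c G' x y = laplacian_entry A g c G x y -
        laplacian_entry A g c G x v * \<sigma> * laplacian_entry A g c G v y"
      if xy: "x \<in> verts G - {v}" "y \<in> verts G - {v}" for x y
    proof -
      define a b :: "nat \<Rightarrow> laurent" where "a i = of_bool (x = t i)" and "b i = of_bool (y = t i)" for i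
      define p q where "p i = mon (\<mu> i)" and "q i = mon (- \<mu> i)" for i
      have pq: "p i * q i = 1" for i by (simp add: p_def q_def mono_mult)
      have star_entry: "edge_matrix v (t i) (s i) (\<mu> i) x y = of_int (s i) * (a i * b i)"
        "edge_matrix v (t i) (s i) (\<mu> i) x v = - (of_int (s i) * (a i * q i))"
        "edge_matrix v (t i) (s i) (\<mu> i) v y = - (of_int (s i) * (b i * p i))" if "i < 3" for i
        using xy t_v [OF that] by (simp_all add: edge_matrix_def a_def b_def p_def q_def)
      have triangle_entry: "edge_matrix (t j) (t k) (- s i) (\<mu> k - \<mu> j) x y =
          - of_int (s i) * (a j * b j + a k * b k - a j * b k * (q j * p k) - a k * b j * (q k * p j))" for i j k
        by (simp add: edge_matrix_def a_def b_def p_def q_def mono_mult algebra_simps)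
      have mods: "(0 + 1) mod 3 = (1::nat)" "(0 + 2) mod 3 = (2::nat)" "(1 + 1) mod 3 = (2::nat)"
        "(1 + 2) mod 3 = (0::nat)" "(2 + 1) mod 3 = (0::nat)" "(2 + 2) mod 3 = (1::nat)" by simp_all
      have G_xy: "laplacian_entry A g c G x y =
          M x y + (of_int (s 0) * (a 0 * b 0) + of_int (s 1) * (a 1 * b 1) + of_int (s 2) * (a 2 * b 2))"
        by (simp add: L sum_lessThan_3 star_entry)
      have G_xv: "laplacian_entry A g c G x v =
          - (of_int (s 0) * (a 0 * q 0) + of_int (s 1) * (a 1 * q 1) + of_int (s 2) * (a 2 * q 2))"
        by (simp add: L outside sum_lessThan_3 star_entry)
      have G_vy: "laplacian_entry A g c G v y =
          - (of_int (s 0) * (b 0 * p 0) + of_int (s 1) * (b 1 * p 1) + of_int (s 2) * (b 2 * p 2))"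
        by (simp add: L outside sum_lessThan_3 star_entry)
      have G'_xy: "laplacian_entry A g c G' x y = M x y
          + (- of_int (s 0) * (a 1 * b 1 + a 2 * b 2 - a 1 * b 2 * (q 1 * p 2) - a 2 * b 1 * (q 2 * p 1))
            - of_int (s 1) * (a 2 * b 2 + a 0 * b 0 - a 2 * b 0 * (q 2 * p 0) - a 0 * b 2 * (q 0 * p 2))
            - of_int (s 2) * (a 0 * b 0 + a 1 * b 1 - a 0 * b 1 * (q 0 * p 1) - a 1 * b 0 * (q 1 * p 0)))"
        unfolding L' sum_lessThan_3 mods triangle_entry by simp
      have \<sigma>_sum: "\<sigma> = of_int (s 0) + of_int (s 1) + of_int (s 2)"
        by (simp add: \<sigma>_def)
      have squares: "of_int (s 0) * of_int (s 0) = (1 :: laurent)" "of_int (s 1) * of_int (s 1) = (1 :: laurent)"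
        "of_int (s 2) * of_int (s 2) = (1 :: laurent)"
        by (rule of_int_facts, simp)+
      note identity = star_triangle_identity [OF pq [of 0] pq [of 1] pq [of 2] squares
          \<sigma>_facts(2-4) [unfolded \<sigma>_sum], of "a 0" "b 0" "a 1" "b 1" "a 2" "b 2"]
      show ?thesis
        unfolding G_xy G_xv G_vy G'_xy \<sigma>_sum identity [symmetric]
        by (simp only: mult_minus_left mult_minus_right minus_minus add_diff_eq)
    qed
  qed
  then show ?thesis
    by (simp add: laplacian_module_eq_cokernel verts')
qed

section \<open>Invariance under Reidemeister graph moves\<close>

lemma elementary_move_isomorphic:
  assumes "symplectic_basis S A g c" "signed_graph_in S A g c G" "signed_graph_in S A g c G'"
    and "elementary_move S A g c G G'"
  shows "modules_isomorphic (laurent_ring g) (laplacian_module A g c G) (laplacian_module A g c G')"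
  using assms move_I_vertex_isomorphic move_I_loop_isomorphic move_II_parallel_isomorphic
    move_II_contract_isomorphic move_III_isomorphic
  unfolding elementary_move_def by metis

theorem proposition3p4:
  fixes S :: "'a::t2_space set" and A :: "'a chart set" and g :: nat
    and c :: "sympl_var \<Rightarrow> real \<Rightarrow> 'a" and G G' :: "('v, 'e, 'a) sgraph"
  assumes "closed_oriented_surface S A g"
    and "symplectic_basis S A g c"
    and "signed_graph_in S A g c G"
    and "signed_graph_in S A g c G'"
    and "reidemeister_graph_move S A g c G G'"
  shows "modules_isomorphic (laurent_ring g) (laplacian_module A g c G) (laplacian_module A g c G')"
proof -
  consider "elementary_move S A g c G G'" | "elementary_move S A g c G' G"
    using assms(5) unfolding reidemeister_graph_move_def by blast
  then show ?thesis
  proof cases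
    case 1
    then show ?thesis
      by (rule elementary_move_isomorphic [OF assms(2-4)])
  next
    case 2
    then have "modules_isomorphic (laurent_ring g) (laplacian_module A g c G') (laplacian_module A g c G)"
      by (rule elementary_move_isomorphic [OF assms(2,4,3)])
    then show ?thesis
      using signed_graph_in_finite(2) [OF assms(4)] by (rule laplacian_modules_isomorphic_sym)
  qed
qed

end
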